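(* For the Poisson $i\mathcal{S}$-graph $G_L$ with $L$ transmission sectors ($L\ge1$), legitimate-node density $\lambda_\ell$ and eavesdropper density $\lambda_{\mathrm e}$, the out-degree $N_{\mathrm{out}}$ of a (typical) node has the following negative binomial probability mass function: $$p_{N_{\mathrm{out}}}(n)=\binom{L+n-1}{L-1}\left(\frac{\lambda_\ell}{\lambda_\ell+\lambda_{\mathrm e}}\right)^{n}\left(\frac{\lambda_{\mathrm e}}{\lambda_\ell+\lambda_{\mathrm e}}\right)^{L},\qquad n\ge0.$$
   Context: $\Pi_\ell=\{x_i\}$ (legitimate nodes) and $\Pi_{\mathrm e}=\{e_k\}$ (eavesdroppers) are mutually independent homogeneous Poisson point processes on $\mathbb{R}^2$ with densities $\lambda_\ell$ and $\lambda_{\mathrm e}$, respectively. Sectorized graph $G_L$: with each legitimate node $x_i$ are associated $L$ transmission sectors $$\mathcal{S}_i^{(l)}=\left\{z\in\mathbb{R}^2:\phi_i+(l-1)\tfrac{2\pi}{L}<\angle\overrightarrow{x_iz}<\phi_i+l\tfrac{2\pi}{L}\right\},\quad l=1,\dots,L,$$ where $\{\phi_i\}_{i=1}^{\infty}$ are random offset angles with an arbitrary joint distribution, and $\angle\overrightarrow{x_iz}$ is the polar angle of $z-x_i$ (modulo $2\pi$). $G_L$ is the directed graph with vertex set $\Pi_\ell$ in which the edge $\overrightarrow{x_ix_j}$ is present if and only if $|x_i-x_j|<|x_i-e^*|$, where $e^*$ is the eavesdropper in $\Pi_{\mathrm e}\cap\mathcal{S}^*$ closest to $x_i$, and $\mathcal{S}^*$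 is the sector $\mathcal{S}_i^{(l)}$ of $x_i$ that contains $x_j$. Typical node: the node at the origin when the graph is built on the legitimate-node set $\Pi_\ell\cup\{0\}$ with eavesdroppers $\Pi_{\mathrm e}$. The out-degree $N_{\mathrm{out}}$ is the number of edges exiting this node, i.e. the number of $x\in\Pi_\ell$ with an edge $\overrightarrow{0x}$.
   Formalization: The family of random offset angles, with arbitrary joint distribution among themselves, is assumed independent of the two Poisson processes; without this the claim fails, e.g. if L=1 and the typical node's offset points at its nearest eavesdropper. *)

theory Defs
  imports "HOL-Probability.Probability" "HOL-Library.Extended_Nat" "Graph_Theory.Pair_Digraph"
begin

type_synonym point = "real ^ 2"

(* A simple point process is given by its random support P w.  The Poisson probabilities are
   written out because poisson_pmf is unspecified at rate 0, which occurs for null sets B. *)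
definition poisson_point_process ::
    "'w measure \<Rightarrow> real \<Rightarrow> ('w \<Rightarrow> point set) \<Rightarrow> bool" where
  "poisson_point_process M lam P \<longleftrightarrow>
     (\<forall>\<omega>\<in>space M. \<forall>B. bounded B \<longrightarrow> finite (P \<omega> \<inter> B)) \<and>
     (\<forall>B\<in>sets borel. bounded B \<longrightarrow>
        (\<lambda>\<omega>. card (P \<omega> \<inter> B)) \<in> M \<rightarrow>\<^sub>M count_space UNIV \<and>
        (\<forall>k. measure M {\<omega>\<in>space M. card (P \<omega> \<inter> B) = k} =
               (lam * measure lborel B) ^ k / fact k * exp (- (lam * measure lborel B)))) \<and>
     (\<forall>m::nat. \<forall>B. (\<forall>i<m. B i \<in> sets borel \<and> bounded (B i)) \<and> disjoint_family_on B {..<m} \<longrightarrow>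
        prob_space.indep_vars M (\<lambda>_. count_space UNIV) (\<lambda>i \<omega>. card (P \<omega> \<inter> B i)) {..<m})"

(* The sigma-algebra on the sample space generated by the counts of the point process. *)
definition point_process_sigma :: "'w measure \<Rightarrow> ('w \<Rightarrow> point set) \<Rightarrow> 'w set set" where
  "point_process_sigma M P =
     sigma_sets (space M)
       {{\<omega>\<in>space M. card (P \<omega> \<inter> B) = k} | B k. B \<in> sets borel \<and> bounded B}"

definition offset_sigma :: "'w measure \<Rightarrow> (nat \<Rightarrow> 'w \<Rightarrow> real) \<Rightarrow> 'w set set" where
  "offset_sigma M \<phi> =
     sigma_sets (space M) {\<phi> i -` A \<inter> space M | i A. A \<in> sets borel}"

(* t is one of the polar angles of v, which are determined modulo 2 * pi. *)
definition polar_angle :: "point \<Rightarrow> real \<Rightarrow> bool" where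
  "polar_angle v t \<longleftrightarrow> v \<noteq> 0 \<and> v = norm v *\<^sub>R vector [cos t, sin t]"

definition sector :: "nat \<Rightarrow> point \<Rightarrow> real \<Rightarrow> nat \<Rightarrow> point set" where
  "sector L x \<phi> l =
     {z. \<exists>t. polar_angle (z - x) t \<and>
             \<phi> + (real l - 1) * (2 * pi / real L) < t \<and> t < \<phi> + real l * (2 * pi / real L)}"

(* For a nonempty locally finite set of eavesdroppers in the sector of y, a closest eavesdropper
   exists and all closest ones are at the same distance.  If there is none, its distance is read
   as infinite and the edge is present. *)
definition iS_edge ::
    "nat \<Rightarrow> (nat \<Rightarrow> point) \<Rightarrow> (nat \<Rightarrow> real) \<Rightarrow> point set \<Rightarrow> nat \<Rightarrow> nat \<Rightarrow> bool" where
  "iS_edge L x \<phi> E i j \<longleftrightarrow>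
     (\<exists>l\<in>{1..L}. x j \<in> sector L (x i) (\<phi> i) l \<and>
        (\<forall>e. is_arg_min (dist (x i)) (\<lambda>e. e \<in> E \<inter> sector L (x i) (\<phi> i) l) e \<longrightarrow>
             dist (x i) (x j) < dist (x i) e))"

definition iS_graph ::
    "nat \<Rightarrow> (nat \<Rightarrow> point) \<Rightarrow> (nat \<Rightarrow> real) \<Rightarrow> point set \<Rightarrow> point pair_pre_digraph" where
  "iS_graph L x \<phi> E =
     \<lparr> pverts = range x, parcs = {(x i, x j) | i j. iS_edge L x \<phi> E i j} \<rparr>"

(* out_degree is 0 for a vertex with infinitely many outgoing arcs. *)
definition ext_out_degree :: "('a, 'b) pre_digraph \<Rightarrow> 'a \<Rightarrow> enat" where
  "ext_out_degree G v = (if finite (out_arcs G v) then enat (out_degree G v) else \<infinity>)"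

(* The typical node 0 is added to the legitimate nodes x 0, x 1, ... as node number 0, so that
   \<phi> 0 is its offset angle and \<phi> (Suc i) that of x i. *)
definition N_out ::
    "nat \<Rightarrow> (nat \<Rightarrow> 'w \<Rightarrow> point) \<Rightarrow> (nat \<Rightarrow> 'w \<Rightarrow> real) \<Rightarrow> ('w \<Rightarrow> point set) \<Rightarrow> 'w \<Rightarrow> enat" where
  "N_out L x \<phi> E \<omega> =
     ext_out_degree
       (with_proj (iS_graph L (case_nat 0 (\<lambda>i. x i \<omega>)) (\<lambda>i. \<phi> i \<omega>) (E \<omega>))) 0"

end

(* Discretise: cut each sector of the typical node into shells of equal area, so that the counts of
   legitimate nodes and eavesdroppers in all cells are independent Poisson variables.  If kappa l is
   the first cell of sector l with an eavesdropper, the out-degree lies between the number of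
   legitimate nodes in the cells before kappa and the number in the cells up to and including kappa.
   Both bounds have explicit generating functions, given by geometric sums, and as the cell area tends
   to 0 both converge to (lam_e / (lam_e + lam_l (1 - s)))^L, which is therefore the generating
   function of the out-degree; its power series coefficients are the negative binomial weights.
   For fixed offset angle the bounds do not depend on that angle, so Fubini's theorem and the
   independence of the offsets remove the randomness of the sectors. *)

theory Submission
  imports Defs "HOL-Real_Asymp.Real_Asymp"
begin

text \<open>Heuristically, the squared distances of all points in one sector form a Poisson process
  on a half-line, in which each point is legitimate with probability
  \<open>lam_l / (lam_l + lam_e)\<close> independently of the rest. The legitimate points before the
  first eavesdropper then have a geometric law, and \<open>L\<close> sectors add up to a negative
  binomial law. The obstacle is that the definition of a Poisson process gives only counts in fixed
  bounded Borel sets, not the ordering of the points. Shells replace that ordering: counts decide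
  which shell is occupied first, and only the nodes in that shell stay undecided. Bounded sets also
  force a truncation to finitely many cells, so a sector may show no eavesdropper at all. The upper
  bound pays for this with the probability of that event, which is one minus the upper expression at
  s = 1; hence the limit is taken at s = 1 too. Otherwise only 0 <= s < 1 occurs, where the power
  with infinite exponent is 0, so a possibly infinite out-degree contributes nothing.\<close>

section \<open>Power series and limits\<close>

text \<open>The first coefficient in which the series differ would be the limit at 0 from the right
  of their difference divided by the matching power of \<open>s\<close>. Only nonnegative
  \<open>s\<close> enter because the generating function is available only there.\<close>

lemma powser_coeffs_unique_right:
  fixes a b f :: "_ \<Rightarrow> real"
  assumes a: "\<And>s. 0 \<le> s \<Longrightarrow> s < 1 \<Longrightarrow> (\<lambda>n. a n * s ^ n) sums f s"
    and b: "\<And>s. 0 \<le> s \<Longrightarrow> s < 1 \<Longrightarrow> (\<lambda>n. b n * s ^ n) sums f s"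
  shows "a n = b n"
proof (induction n rule: less_induct)
  case (less k)
  define c where "c n = a (n + k) - b (n + k)" for n
  have c0: "(\<lambda>n. c n * s ^ n) sums 0" if s: "0 < s" "s < 1" for s
  proof -
    have "(\<lambda>n. (a n - b n) * s ^ n) sums 0"
      using sums_diff[OF a[of s] b[of s]] s by (simp add: algebra_simps)
    then have "(\<lambda>n. (a (n + k) - b (n + k)) * s ^ (n + k)) sums 0"
      using sums_iff_shift[of "\<lambda>n. (a n - b n) * s ^ n" k 0] less by simp
    then have "(\<lambda>n. (1 / s ^ k) * ((a (n + k) - b (n + k)) * s ^ (n + k))) sums ((1 / s ^ k) * 0)"
      by (rule sums_mult)
    moreover have "(1 / s ^ k) * ((a (n + k) - b (n + k)) * s ^ (n + k)) = c n * s ^ n" for n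
      using s by (simp add: c_def power_add)
    ultimately show ?thesis by simp
  qed
  \<comment> \<open>Convergence at the one point 1/2 gives convergence on a two-sided neighbourhood
    of 0, as the limit theorem for power series requires; that the sum vanishes is used from the
    right only.\<close>
  have sm: "summable (\<lambda>n. c n * (1/2) ^ n)"
    using c0[of "1/2"] by (auto simp: sums_iff)
  then have "(\<lambda>n. c n * x ^ n) sums (\<Sum>n. c n * x ^ n)" if "norm x < 1/2" for x :: real
    using powser_inside[OF sm, of x] that by (auto simp: summable_sums)
  then have "((\<lambda>x. \<Sum>n. c n * x ^ n) \<longlongrightarrow> c 0) (at 0)"
    by (intro powser_limit_0[of "1/2"]) auto
  then have "((\<lambda>x. \<Sum>n. c n * x ^ n) \<longlongrightarrow> c 0) (at_right 0)"
    by (rule filterlim_at_split[THEN iffD1, THEN conjunct2])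
  moreover have "\<forall>\<^sub>F x in at_right 0. (\<Sum>n. c n * x ^ n) = 0"
    using eventually_at_right_real[of 0 1, OF zero_less_one]
    by (rule eventually_mono) (use c0 in \<open>auto simp: sums_iff\<close>)
  ultimately have "((\<lambda>x. 0) \<longlongrightarrow> c 0) (at_right (0::real))"
    using tendsto_cong[of "\<lambda>x. \<Sum>n. c n * x ^ n" "\<lambda>_. 0" "at_right 0"] by simp
  then have "c 0 = 0"
    by (simp add: tendsto_const_iff)
  then show ?case by (simp add: c_def)
qed

text \<open>Newton's binomial series with exponent \<open>- L\<close>; negating the upper index
  turns its coefficients into ordinary binomial coefficients.\<close>

lemma neg_binomial_series:
  fixes x :: real
  assumes "\<bar>x\<bar> < 1" "1 \<le> L"
  shows "(\<lambda>n. real ((L + n - 1) choose (L - 1)) * x ^ n) sums (1 / (1 - x) ^ L)"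
proof -
  have "(\<lambda>n. ((- real L) gchoose n) * (- x) ^ n) sums (1 + (- x)) powr (- real L)"
    using assms by (intro gen_binomial_real) auto
  moreover have "((- real L) gchoose n) * (- x) ^ n = real ((L + n - 1) choose (L - 1)) * x ^ n" for n
  proof -
    have "(- real L) gchoose n = (-1) ^ n * ((real (L + n - 1)) gchoose n)"
      using assms gbinomial_minus[of "real L" n] by (simp add: of_nat_diff algebra_simps)
    also have "(real (L + n - 1)) gchoose n = real ((L + n - 1) choose n)"
      by (simp add: binomial_gbinomial)
    also have "(L + n - 1) choose n = (L + n - 1) choose (L - 1)"
      using assms binomial_symmetric[of n "L + n - 1"] by simp
    finally have "(- real L gchoose n) * (- x) ^ n =
        ((-1) ^ n * (- x) ^ n) * real ((L + n - 1) choose (L - 1))" by simp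
    also have "(-1 :: real) ^ n * (- x) ^ n = x ^ n"
      by (simp flip: power_mult_distrib)
    finally show ?thesis by simp
  qed
  moreover have "(1 + (- x)) powr (- real L) = 1 / (1 - x) ^ L"
    using assms by (simp add: powr_minus powr_realpow field_simps)
  ultimately show ?thesis by simp
qed

text \<open>The mesh is \<open>1 / (m + 1)\<close> and there are \<open>(m + 1)\<^sup>2\<close> cells, so the cells shrink while the
  region that they cover grows to the whole sector.\<close>

lemma riemann_geometric_limit:
  fixes b c :: real
  assumes "0 < b" "0 \<le> c"
  defines "q \<equiv> (\<lambda>m. exp (- (b / real (Suc m))))"
    and "g \<equiv> (\<lambda>m. exp (- (c / real (Suc m))))"
  shows "(\<lambda>m. (\<Sum>k<(Suc m)\<^sup>2. (q m * g m) ^ k * (1 - q m)) ^ L) \<longlonglongrightarrow> (b / (b + c)) ^ L"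
    and "g \<longlonglongrightarrow> 1" 
proof -
  show "g \<longlonglongrightarrow> 1" unfolding g_def by real_asymp
  have "(\<lambda>m. (\<Sum>k<(Suc m)\<^sup>2. (q m * g m) ^ k * (1 - q m))) \<longlonglongrightarrow> b / (b + c)"
  proof -
    have pos: "b + c > 0" using assms by simp
    have eq: "(\<Sum>k<(Suc m)\<^sup>2. (q m * g m) ^ k * (1 - q m)) =
       (1 - exp (- (b / real (Suc m)))) * (1 - exp (- ((b + c) * real (Suc m))))
         / (1 - exp (- ((b + c) / real (Suc m))))" for m
    proof -
      have qg: "q m * g m = exp (- ((b + c) / real (Suc m)))"
        by (simp add: q_def g_def flip: exp_add) (simp add: add_divide_distrib)
      have "q m * g m < 1" unfolding qg using pos by simp
      then have "(\<Sum>k<(Suc m)\<^sup>2. (q m * g m) ^ k) = (1 - (q m * g m) ^ ((Suc m)\<^sup>2)) / (1 - q m * g m)"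
        by (simp add: sum_gp_strict)
      \<comment> \<open>The number of cells times the mesh is \<open>m + 1\<close>, so this
        truncation term vanishes as \<open>m\<close> grows.\<close>
      moreover have "(q m * g m) ^ ((Suc m)\<^sup>2) = exp (- ((b + c) * real (Suc m)))"
      proof -
        have "real ((Suc m)\<^sup>2) * - ((b + c) / real (Suc m)) = - ((b + c) * real (Suc m))"
        proof -
          define N where "N = real (Suc m)"
          have "N \<noteq> 0" "real ((Suc m)\<^sup>2) = N * N"
            unfolding N_def power2_eq_square of_nat_mult by simp_all
          then show ?thesis unfolding N_def[symmetric] by simp
        qed
        then show ?thesis unfolding qg exp_of_nat_mult[symmetric] by (rule arg_cong)
      qed
      ultimately show ?thesis
        using qg by (simp add: q_def flip: sum_distrib_right)
    qed
    show ?thesis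
      unfolding eq using assms(1) pos by real_asymp (simp add: field_simps)
  qed
  then show "(\<lambda>m. (\<Sum>k<(Suc m)\<^sup>2. (q m * g m) ^ k * (1 - q m)) ^ L) \<longlonglongrightarrow> (b / (b + c)) ^ L"
    by (rule tendsto_power)
qed

section \<open>Geometry of sectors\<close>

lemma polar_angle_iff_cis:
  "polar_angle v t \<longleftrightarrow> v \<noteq> 0 \<and> Complex (v $ 1) (v $ 2) = of_real (norm v) * cis t"
  by (auto simp: polar_angle_def vec_eq_iff forall_2 complex_eq_iff)

lemma norm_vec2_complex: "norm (v :: real ^ 2) = cmod (Complex (v $ 1) (v $ 2))"
  by (simp add: norm_vec_def L2_set_def sum_2 cmod_def)

text \<open>Turning the bisector of the sector onto the positive real axis makes the sector
  symmetric, so that it avoids the branch cut of \<open>Arg\<close> even when it is the whole slit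
  plane (\<open>L = 1\<close>).\<close>

lemma sector_iff_Arg:
  assumes "1 \<le> L"
  shows "z \<in> sector L x \<phi> l \<longleftrightarrow>
    (let w = Complex ((z - x) $ 1) ((z - x) $ 2) * cis (- (\<phi> + (real l - 1/2) * (2 * pi / real L)))
     in w \<noteq> 0 \<and> \<bar>Arg w\<bar> < pi / real L)"
proof -
  define v where "v = z - x"
  \<comment> \<open>The direction of the bisector; the half-width of the sector is
    \<open>pi / real L\<close>.\<close>
  define c where "c = \<phi> + (real l - 1/2) * (2 * pi / real L)"
  define u where "u = Complex (v $ 1) (v $ 2)"
  define w where "w = u * cis (- c)"
  have L: "real L \<ge> 1" using assms by simp
  have le: "pi / real L \<le> pi" using L pi_gt_zero by (simp add: field_simps)
  have nw: "cmod w = norm v" by (simp add: w_def norm_mult norm_vec2_complex u_def)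
  have w0: "w = 0 \<longleftrightarrow> v = 0"
    using nw by (metis norm_eq_zero)
  have lo: "\<phi> + (real l - 1) * (2 * pi / real L) = c - pi / real L"
    and hi: "\<phi> + real l * (2 * pi / real L) = c + pi / real L"
    using L by (simp_all add: c_def field_simps)
  have "z \<in> sector L x \<phi> l \<longleftrightarrow> (\<exists>t. polar_angle v t \<and> c - pi / real L < t \<and> t < c + pi / real L)"
    unfolding sector_def lo hi v_def by simp
  also have "\<dots> \<longleftrightarrow> (\<exists>t. v \<noteq> 0 \<and> w = of_real (cmod w) * cis (t - c) \<and> \<bar>t - c\<bar> < pi / real L)"
  proof -
    have "u = of_real (norm v) * cis t \<longleftrightarrow> w = of_real (cmod w) * cis (t - c)" for t
    proof -
      have "u = of_real (norm v) * cis t \<longleftrightarrow> u * cis (- c) = of_real (norm v) * cis t * cis (- c)"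
        by simp
      also have "of_real (norm v) * cis t * cis (- c) = of_real (norm v) * cis (t - c)"
        by (simp add: mult.assoc cis_mult)
      finally show ?thesis by (simp add: w_def[symmetric] nw)
    qed
    then show ?thesis
      by (simp add: polar_angle_iff_cis u_def[symmetric]) (smt (verit))
  qed
  also have "\<dots> \<longleftrightarrow> w \<noteq> 0 \<and> \<bar>Arg w\<bar> < pi / real L"
  proof (safe)
    fix t assume "v \<noteq> 0" "w = of_real (cmod w) * cis (t - c)" "\<bar>t - c\<bar> < pi / real L"
    then have "Arg w = t - c"
      using le w0 by (intro cis_Arg_unique) (auto simp: sgn_eq field_simps)
    then show "\<bar>Arg w\<bar> < pi / real L" using \<open>\<bar>t - c\<bar> < _\<close> by simp
  next
    assume "w \<noteq> 0" "\<bar>Arg w\<bar> < pi / real L"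
    moreover have "w = of_real (cmod w) * cis (Arg w)"
      using \<open>w \<noteq> 0\<close> by (simp add: cis_Arg sgn_eq)
    ultimately show "\<exists>t. v \<noteq> 0 \<and> w = of_real (cmod w) * cis (t - c) \<and> \<bar>t - c\<bar> < pi / real L"
      using w0 by (intro exI[of _ "c + Arg w"]) auto
  next
    assume "w = 0" "v \<noteq> 0" then show False using w0 by simp
  qed
  finally show ?thesis by (simp add: Let_def w_def u_def v_def c_def)
qed

text \<open>Openness is joint in apex, offset and point, so that membership stays measurable when
  all three are random.\<close>

lemma open_sector_graph:
  assumes "1 \<le> L"
  shows "open {p :: (point \<times> real) \<times> point. snd p \<in> sector L (fst (fst p)) (snd (fst p)) l}"
proof -
  define A where "A = {w :: complex. w \<noteq> 0 \<and> \<bar>Arg w\<bar> < pi / real L}"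
  have le: "pi / real L \<le> pi" using assms pi_gt_zero by (simp add: field_simps)
  have A: "A = (- \<real>\<^sub>\<le>\<^sub>0) \<inter> Arg -` {- (pi / real L) <..< pi / real L}"
  proof -
    have "w \<notin> \<real>\<^sub>\<le>\<^sub>0" if "w \<noteq> 0" "\<bar>Arg w\<bar> < pi / real L" for w
    proof
      assume "w \<in> \<real>\<^sub>\<le>\<^sub>0"
      then have "Arg w = pi"
        using that Arg_eq_pi[of w] by (auto simp: complex_nonpos_Reals_iff complex_eq_iff)
      then show False using that le by simp
    qed
    then show ?thesis unfolding A_def by auto
  qed
  have "continuous_on (- \<real>\<^sub>\<le>\<^sub>0) Arg"
    by (auto intro!: continuous_at_imp_continuous_on continuous_at_Arg)
  then have "open A"
    unfolding A by (intro continuous_open_preimage) (auto simp: open_Compl)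
  moreover have "{p :: (point \<times> real) \<times> point. snd p \<in> sector L (fst (fst p)) (snd (fst p)) l} =
     (\<lambda>p. Complex ((snd p - fst (fst p)) $ 1) ((snd p - fst (fst p)) $ 2) *
        cis (- (snd (fst p) + (real l - 1/2) * (2 * pi / real L)))) -` A"
    unfolding sector_iff_Arg[OF assms] A_def Let_def by auto
  moreover have "continuous_on UNIV (\<lambda>p :: (point \<times> real) \<times> point.
     Complex ((snd p - fst (fst p)) $ 1) ((snd p - fst (fst p)) $ 2) *
        cis (- (snd (fst p) + (real l - 1/2) * (2 * pi / real L))))"
    unfolding Complex_eq by (intro continuous_intros)
  ultimately show ?thesis
    by (simp add: open_vimage)
qed

lemma open_sector:
  assumes "1 \<le> L"
  shows "open (sector L x \<phi> l)"
proof -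
  have "open ((\<lambda>z. ((x, \<phi>), z)) -`
      {p :: (point \<times> real) \<times> point. snd p \<in> sector L (fst (fst p)) (snd (fst p)) l})"
    by (intro open_vimage open_sector_graph assms continuous_intros)
  then show ?thesis by (simp add: vimage_def)
qed

text \<open>Two polar angles of one point differ by a multiple of \<open>2 * pi\<close>, and both
  lie in the same open interval of length \<open>2 * pi\<close> after the offset, so they
  coincide.\<close>

lemma sector_disjoint:
  assumes "l \<in> {1..L}" "l' \<in> {1..L}" "l \<noteq> l'"
  shows "sector L x \<phi> l \<inter> sector L x \<phi> l' = {}"
proof (rule ccontr)
  assume "\<not> ?thesis"
  then obtain z where z: "z \<in> sector L x \<phi> l" "z \<in> sector L x \<phi> l'" by auto
  define d where "d = 2 * pi / real L"
  have d: "d > 0" "real L * d = 2 * pi" using assms by (auto simp: d_def)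
  obtain t where t: "polar_angle (z - x) t" "\<phi> + (real l - 1) * d < t" "t < \<phi> + real l * d"
    using z unfolding sector_def d_def by auto
  obtain t' where t': "polar_angle (z - x) t'" "\<phi> + (real l' - 1) * d < t'" "t' < \<phi> + real l' * d"
    using z unfolding sector_def d_def by auto
  have bnd: "0 \<le> (real k - 1) * d" "real k * d \<le> 2 * pi" if "k \<in> {1..L}" for k
    using that d by (auto simp: mult_right_mono simp flip: d(2))
  have lt: "\<bar>t - t'\<bar> < 2 * pi"
    using t t' bnd[OF assms(1)] bnd[OF assms(2)] by linarith
  have "cis t = cis t'"
    using t(1) t'(1) by (auto simp: polar_angle_iff_cis)
  then have "cis (t - t') = 1"
    by (metis cis_divide cis_neq_zero divide_self)
  then have "cos (t - t') = 1" by (simp add: complex_eq_iff)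
  then obtain n :: int where n: "t - t' = 2 * pi * real_of_int n"
    using cos_one_2pi_int by (auto simp: mult_ac)
  then have "\<bar>real_of_int n\<bar> < 1"
    using lt by (simp add: abs_mult)
  then have "n = 0" by linarith
  then have "t = t'" using n by simp
  then have "(real l - 1) * d < real l' * d" "(real l' - 1) * d < real l * d"
    using t t' by linarith+
  then have "real l - 1 < real l'" "real l' - 1 < real l"
    using d(1) by (simp_all add: mult_less_cancel_right)
  then show False using assms(3) by linarith
qed

section \<open>Rotations, annuli and areas\<close>

definition rot2 :: "real \<Rightarrow> point \<Rightarrow> point" where
  "rot2 \<theta> v = vector [cos \<theta> * v $ 1 - sin \<theta> * v $ 2, sin \<theta> * v $ 1 + cos \<theta> * v $ 2]"

lemma Complex_rot2: "Complex (rot2 \<theta> v $ 1) (rot2 \<theta> v $ 2) = cis \<theta> * Complex (v $ 1) (v $ 2)"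
  by (simp add: rot2_def complex_eq_iff algebra_simps)

lemma norm_rot2 [simp]: "norm (rot2 \<theta> v) = norm v"
  by (simp add: norm_vec2_complex Complex_rot2 norm_mult)

lemma orthogonal_transformation_rot2: "orthogonal_transformation (rot2 \<theta>)"
  unfolding orthogonal_transformation
proof (intro conjI allI)
  show "linear (rot2 \<theta>)"
    by (rule linearI) (simp_all add: rot2_def vec_eq_iff forall_2 algebra_simps)
qed simp

lemma rot2_rot2: "rot2 \<theta> (rot2 \<eta> v) = rot2 (\<theta> + \<eta>) v"
  by (simp add: rot2_def vec_eq_iff forall_2 cos_add sin_add algebra_simps)

lemma rot2_0 [simp]: "rot2 0 v = v"
  by (simp add: rot2_def vec_eq_iff forall_2)

lemma polar_angle_rot2: "polar_angle v t \<Longrightarrow> polar_angle (rot2 \<theta> v) (t + \<theta>)"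
  unfolding polar_angle_iff_cis norm_rot2 Complex_rot2
  by (metis (no_types, lifting) add.commute cis_mult mult.left_commute norm_eq_zero norm_rot2)

lemma sector_rot2:
  "sector L 0 \<phi> l = rot2 ((real l - 1) * (2 * pi / real L)) ` sector L 0 \<phi> 1"
proof -
  define d where "d = 2 * pi / real L"
  let ?\<theta> = "(real l - 1) * d"
  have "rot2 ?\<theta> z \<in> sector L 0 \<phi> l" if "z \<in> sector L 0 \<phi> 1" for z
  proof -
    obtain t where "polar_angle z t" "\<phi> < t" "t < \<phi> + d"
      using \<open>z \<in> sector L 0 \<phi> 1\<close> unfolding sector_def d_def by auto
    then show ?thesis
      using polar_angle_rot2[of z t ?\<theta>] unfolding sector_def d_def[symmetric]
      by (auto intro!: exI[of _ "t + ?\<theta>"] simp: algebra_simps)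
  qed
  moreover have "rot2 (- ?\<theta>) z \<in> sector L 0 \<phi> 1" if "z \<in> sector L 0 \<phi> l" for z
  proof -
    obtain t where "polar_angle z t" "\<phi> + (real l - 1) * d < t" "t < \<phi> + real l * d"
      using \<open>z \<in> sector L 0 \<phi> l\<close> unfolding sector_def d_def by auto
    then show ?thesis
      using polar_angle_rot2[of z t "- ?\<theta>"] unfolding sector_def d_def[symmetric]
      by (auto intro!: exI[of _ "t - ?\<theta>"] simp: algebra_simps)
  qed
  moreover have "rot2 ?\<theta> (rot2 (- ?\<theta>) z) = z" for z by (simp add: rot2_rot2)
  ultimately show ?thesis
    unfolding d_def[symmetric] by (auto intro: image_eqI[where x = "rot2 (- ?\<theta>) _"])
qed

text \<open>The bounds are squared radii, so that the area is linear in them and equal steps give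
  equal areas; half-open intervals let consecutive annuli tile the plane.\<close>

definition annulus :: "real \<Rightarrow> real \<Rightarrow> point set" where
  "annulus a b = {z. a \<le> (norm z)\<^sup>2 \<and> (norm z)\<^sup>2 < b}"

lemma annulus_borel [measurable]: "annulus a b \<in> sets borel"
  unfolding annulus_def by measurable

lemma bounded_annulus: "bounded (annulus a b)"
proof -
  have "annulus a b \<subseteq> ball 0 (sqrt b)"
    by (auto simp: annulus_def dist_norm intro: real_less_rsqrt)
  then show ?thesis using bounded_ball bounded_subset by blast
qed

lemma lmeasurable_bounded_borel: "B \<in> sets borel \<Longrightarrow> bounded B \<Longrightarrow> B \<in> lmeasurable"
  by (rule bounded_set_imp_lmeasurable) simp_all

lemma measure_annulus:
  assumes "0 \<le> a" "a \<le> b"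
  shows "measure lborel (annulus a b) = pi * (b - a)"
proof -
  have eq: "annulus a b = ball 0 (sqrt b) - ball 0 (sqrt a)"
  proof -
    have "(norm z)\<^sup>2 < c \<longleftrightarrow> norm z < sqrt c" for z :: point and c
      by (metis norm_ge_zero real_less_lsqrt real_less_rsqrt real_sqrt_less_iff real_sqrt_unique real_sqrt_power)
    then show ?thesis by (auto simp: annulus_def simp flip: not_less)
  qed
  have ball: "measure lborel (ball (0::point) (sqrt c)) = pi * c" if "0 \<le> c" for c
    using that content_ball[of "sqrt c" "0::point"] by (simp add: unit_ball_vol_2)
  have "measure lborel (annulus a b) =
      measure lborel (ball (0::point) (sqrt b)) - measure lborel (ball (0::point) (sqrt a))"
    unfolding eq using assms emeasure_bounded_finite[of "ball (0::point) (sqrt b)"]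
    by (intro measure_Diff) (auto simp: subset_ball)
  then show ?thesis using assms by (simp add: ball algebra_simps)
qed

text \<open>The set is the whole line through the origin in direction \<open>t\<close>, a hyperplane
  that contains the boundary ray at that angle.\<close>

lemma negligible_ray: "negligible {z :: point. sin t * z $ 1 = cos t * z $ 2}"
proof -
  have "{z :: point. sin t * z $ 1 = cos t * z $ 2} = {z. vector [sin t, - cos t] \<bullet> z = 0}"
    by (auto simp: inner_vec_def sum_2)
  moreover have "sin t \<noteq> 0 \<or> cos t \<noteq> 0"
    by (metis sin_cos_squared_add zero_power2 add_0 zero_neq_one)
  then have "vector [sin t, - cos t] \<noteq> (0 :: point)"
    by (auto simp: vec_eq_iff forall_2)
  ultimately show ?thesis using negligible_hyperplane by auto
qed

lemma in_sector_or_ray: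
  assumes "1 \<le> L"
  shows "(\<exists>l\<in>{1..L}. z \<in> sector L 0 \<phi> l) \<or>
    (\<exists>l\<in>{1..L}. let t = \<phi> + (real l - 1) * (2 * pi / real L) in sin t * z $ 1 = cos t * z $ 2)"
proof (cases "z = 0")
  \<comment> \<open>The origin lies in no sector, but on every boundary line.\<close>
  case True
  then show ?thesis using assms by auto
next
  case False
  define d where "d = 2 * pi / real L"
  have d: "d > 0" "real L * d = 2 * pi" using assms by (auto simp: d_def)
  define u where "u = Complex (z $ 1) (z $ 2) * cis (- \<phi>)"
  have "Complex (z $ 1) (z $ 2) \<noteq> 0" using False by (auto simp: complex_eq_iff vec_eq_iff forall_2)
  then have "u \<noteq> 0" by (simp add: u_def)
  \<comment> \<open>\<open>Arg2pi\<close> has values from 0 up to, but excluding,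
    \<open>2 * pi\<close>: the range swept by the \<open>L\<close> sectors when angles are measured
    from the offset.\<close>
  define a where "a = Arg2pi u"
  have a: "0 \<le> a" "a < 2 * pi" "u = of_real (cmod u) * cis a"
    using Arg2pi[of u] unfolding a_def cis_conv_exp is_Arg_def by (auto simp: mult_ac)
  have pa: "polar_angle z (\<phi> + a)"
  proof -
    have "u * cis \<phi> = of_real (cmod u) * cis a * cis \<phi>" using a(3) by simp
    then show ?thesis
      using False by (simp add: polar_angle_iff_cis u_def mult.assoc cis_mult norm_mult norm_vec2_complex add.commute)
  qed
  \<comment> \<open>The successor appears because sectors are numbered from 1; an exact multiple of
    the width is a boundary ray.\<close>
  define l where "l = Suc (nat \<lfloor>a / d\<rfloor>)"
  have fl: "real l - 1 = of_int \<lfloor>a / d\<rfloor>"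
    using a d by (simp add: l_def)
  have "real l - 1 \<le> a / d" "a / d < real l"
    using floor_correct[of "a / d"] fl by linarith+
  then have lo: "(real l - 1) * d \<le> a" "a < real l * d"
    using d(1) by (simp_all only: pos_le_divide_eq pos_divide_less_eq)
  have "(real l - 1) * d < real L * d" using lo a d by linarith
  then have "real l - 1 < real L" using d(1) by (simp only: mult_less_cancel_right_pos)
  then have l: "l \<in> {1..L}" by (auto simp: l_def)
  show ?thesis
  proof (cases "(real l - 1) * d = a")
    case True
    have "z = norm z *\<^sub>R vector [cos (\<phi> + a), sin (\<phi> + a)]"
      using pa by (simp add: polar_angle_def)
    from arg_cong[OF this, of "\<lambda>v. v $ 1"] arg_cong[OF this, of "\<lambda>v. v $ 2"]
    have "z $ 1 = norm z * cos (\<phi> + a)" "z $ 2 = norm z * sin (\<phi> + a)" by simp_all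
    then have "sin (\<phi> + (real l - 1) * d) * z $ 1 = cos (\<phi> + (real l - 1) * d) * z $ 2"
      by (simp add: True)
    then show ?thesis using l unfolding Let_def d_def by blast
  next
    case False
    then have "z \<in> sector L 0 \<phi> l"
      using lo pa unfolding sector_def d_def[symmetric]
      by (auto intro!: exI[of _ "\<phi> + a"])
    then show ?thesis using l by auto
  qed
qed

text \<open>The \<open>L\<close> sectors are rotations of each other and cover the plane up to finitely many rays.\<close>

lemma measure_sector_annulus:
  assumes "1 \<le> L" "l \<in> {1..L}" "0 \<le> a" "a \<le> b"
  shows "measure lborel (sector L 0 \<phi> l \<inter> annulus a b) = pi * (b - a) / real L"
proof -
  define S where "S l = sector L 0 \<phi> l \<inter> annulus a b" for l
  have S_borel: "S l \<in> sets borel" for l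
    unfolding S_def using borel_open[OF open_sector[OF assms(1)]] by simp
  have S_lm: "S l \<in> lmeasurable" for l
    using S_borel bounded_annulus by (intro lmeasurable_bounded_borel) (auto simp: S_def)
  have inD: "rot2 \<theta> ` annulus a b = annulus a b" for \<theta>
  proof -
    have "rot2 \<theta> z \<in> annulus a b" if "z \<in> annulus a b" for \<theta> z
      using that by (simp add: annulus_def)
    moreover have "rot2 \<theta> (rot2 (- \<theta>) z) = z" for z by (simp add: rot2_rot2)
    ultimately show ?thesis by (auto intro: image_eqI[where x = "rot2 (- \<theta>) _"])
  qed
  have inj: "inj (rot2 \<theta>)" for \<theta>
    by (rule orthogonal_transformation_inj[OF orthogonal_transformation_rot2])
  have rotS: "S l = rot2 ((real l - 1) * (2 * pi / real L)) ` S 1" for l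
    unfolding S_def by (subst sector_rot2) (simp add: image_Int[OF inj] inD)
  have "measure lebesgue (S l) = measure lebesgue (S 1)" for l
    by (subst rotS) (rule measure_orthogonal_image[OF orthogonal_transformation_rot2 S_lm])
  then have same: "measure lborel (S l) = measure lborel (S 1)" for l
    using S_borel by (simp add: measure_completion)
  define N where "N = (\<Union>l\<in>{1..L}. {z :: point. sin (\<phi> + (real l - 1) * (2 * pi / real L)) * z $ 1 =
      cos (\<phi> + (real l - 1) * (2 * pi / real L)) * z $ 2})"
  have "negligible N" unfolding N_def by (intro negligible_Union) (auto intro: negligible_ray)
  have "measure lebesgue (annulus a b) = measure lebesgue (\<Union>l\<in>{1..L}. S l)"
  proof (rule measure_negligible_symdiff)
    have "(\<Union>l\<in>{1..L}. S l) - annulus a b \<union> (annulus a b - (\<Union>l\<in>{1..L}. S l)) \<subseteq> N"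
      using in_sector_or_ray[OF assms(1), of _ \<phi>] by (fastforce simp: S_def N_def Let_def)
    then show "negligible ((\<Union>l\<in>{1..L}. S l) - annulus a b \<union> (annulus a b - (\<Union>l\<in>{1..L}. S l)))"
      using \<open>negligible N\<close> negligible_subset by blast
    show "(\<Union>l\<in>{1..L}. S l) \<in> lmeasurable"
      using S_lm by (intro fmeasurable.finite_UN) auto
  qed
  also have "\<dots> = measure lborel (\<Union>l\<in>{1..L}. S l)"
    using S_borel by (intro measure_completion) auto
  also have "\<dots> = (\<Sum>l\<in>{1..L}. measure lborel (S l))"
  proof (rule measure_finite_Union)
    show "disjoint_family_on S {1..L}"
      using sector_disjoint[of _ L _ 0 \<phi>] by (fastforce simp: disjoint_family_on_def S_def)
    show "emeasure lborel (S l) \<noteq> \<infinity>" for l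
      using emeasure_bounded_finite[of "S l"]
        bounded_subset[OF bounded_annulus, of "S l" a b] by (auto simp: S_def)
  qed (use S_borel in auto)
  also have "\<dots> = real L * measure lborel (S 1)" by (subst same) simp
  finally have "real L * measure lborel (S 1) = pi * (b - a)"
    using measure_annulus[OF assms(3,4)] by (simp add: measure_completion)
  then show ?thesis
    using same[of l] assms(1) by (simp add: S_def field_simps)
qed

section \<open>Measurability of counts in random sets\<close>

definition locally_finite :: "point set \<Rightarrow> bool" where
  "locally_finite X \<longleftrightarrow> (\<forall>B. bounded B \<longrightarrow> finite (X \<inter> B))"

text \<open>Counts are assumed measurable only for fixed sets, but the sectors are random. The sets
  whose sections have measurable counts contain the rectangles and are closed under complements and
  disjoint unions, so Dynkin's theorem gives the whole product sigma-algebra. The bounded window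
  \<open>R\<close> keeps all counts finite.\<close>

lemma measurable_count_section_bounded:
  assumes lf: "\<And>\<omega>. \<omega> \<in> space F \<Longrightarrow> locally_finite (P \<omega>)"
    and meas: "\<And>B. B \<in> sets borel \<Longrightarrow> bounded B \<Longrightarrow> (\<lambda>\<omega>. card (P \<omega> \<inter> B)) \<in> F \<rightarrow>\<^sub>M count_space UNIV"
    and C: "C \<in> sets (N \<Otimes>\<^sub>M borel)" and R: "R \<in> sets borel" "bounded R"
  shows "(\<lambda>(y, \<omega>). card (P \<omega> \<inter> (R \<inter> Pair y -` C))) \<in> N \<Otimes>\<^sub>M F \<rightarrow>\<^sub>M count_space UNIV"
proof -
  note [measurable] = meas R
  have fin: "finite (P \<omega> \<inter> (R \<inter> A))" if "\<omega> \<in> space F" for \<omega> A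
    using lf[OF that] R(2) bounded_subset[of R "R \<inter> A"] by (auto simp: locally_finite_def)
  define G where "G = {a \<times> b | a b. a \<in> sets N \<and> b \<in> sets (borel :: point measure)}"
  have "Int_stable G" unfolding G_def by (rule Int_stable_pair_measure_generator)
  moreover have "G \<subseteq> Pow (space N \<times> space (borel :: point measure))"
    unfolding G_def by (rule pair_measure_closed)
  moreover have "C \<in> sigma_sets (space N \<times> space (borel :: point measure)) G"
    using C by (simp add: sets_pair_measure G_def)
  ultimately show ?thesis
  proof (induction rule: sigma_sets_induct_disjoint)
    case (basic A)
    then obtain a b where A: "A = a \<times> b" and [measurable]: "a \<in> sets N" "b \<in> sets borel" by (auto simp: G_def)
    have "(\<lambda>\<omega>. card (P \<omega> \<inter> (R \<inter> b))) \<in> F \<rightarrow>\<^sub>M count_space UNIV"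
      using R by (intro meas) (auto intro: bounded_subset)
    then have "(\<lambda>(y, \<omega>). if y \<in> a then card (P \<omega> \<inter> (R \<inter> b)) else 0) \<in> N \<Otimes>\<^sub>M F \<rightarrow>\<^sub>M count_space UNIV"
      by measurable
    moreover have "(\<lambda>(y, \<omega>). if y \<in> a then card (P \<omega> \<inter> (R \<inter> b)) else 0) =
        (\<lambda>(y, \<omega>). card (P \<omega> \<inter> (R \<inter> Pair y -` A)))"
      by (auto simp: A fun_eq_iff vimage_def)
    ultimately show ?case by simp
  next
    case empty
    then show ?case by simp
  next
    case (compl A)
    have "(\<lambda>\<omega>. card (P \<omega> \<inter> R)) \<in> F \<rightarrow>\<^sub>M count_space UNIV"
      using R by (intro meas) auto
    \<comment> \<open>Finite counts turn the complement within the window into a subtraction of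
      naturals.\<close>
    then have "(\<lambda>(y, \<omega>). card (P \<omega> \<inter> R) - card (P \<omega> \<inter> (R \<inter> Pair y -` A))) \<in> N \<Otimes>\<^sub>M F \<rightarrow>\<^sub>M count_space UNIV"
      using compl.IH by (simp add: case_prod_beta') 
    then show ?case
    proof (rule measurable_cong[THEN iffD1, rotated], clarsimp simp: space_pair_measure)
      fix y \<omega> assume "y \<in> space N" "\<omega> \<in> space F"
      then have "P \<omega> \<inter> (R \<inter> Pair y -` (space N \<times> UNIV - A)) = P \<omega> \<inter> R - P \<omega> \<inter> (R \<inter> Pair y -` A)"
        by auto
      moreover have "card (P \<omega> \<inter> R - P \<omega> \<inter> (R \<inter> Pair y -` A)) =
          card (P \<omega> \<inter> R) - card (P \<omega> \<inter> (R \<inter> Pair y -` A))"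
        using fin[OF \<open>\<omega> \<in> space F\<close>] by (intro card_Diff_subset) auto
      ultimately show "card (P \<omega> \<inter> R) - card (P \<omega> \<inter> (R \<inter> Pair y -` A)) =
          card (P \<omega> \<inter> (R \<inter> Pair y -` (space N \<times> UNIV - A)))"
        by simp
    qed
  next
    case (union A)
    have "(\<lambda>x. \<Sum>i. ennreal (real (case x of (y, \<omega>) \<Rightarrow> card (P \<omega> \<inter> (R \<inter> Pair y -` A i)))))
        \<in> borel_measurable (N \<Otimes>\<^sub>M F)"
      using union.IH by measurable
    moreover have "(\<Sum>i. ennreal (real (card (P \<omega> \<inter> (R \<inter> Pair y -` A i))))) =
        ennreal (real (card (P \<omega> \<inter> (R \<inter> Pair y -` (\<Union>i. A i)))))" if "\<omega> \<in> space F" for y \<omega>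
    proof -
      \<comment> \<open>Counting measure on the points in the window turns the disjoint union into a
        series of extended reals.\<close>
      let ?Q = "count_space (P \<omega> \<inter> R)"
      have card: "emeasure ?Q (P \<omega> \<inter> (R \<inter> B)) = ennreal (real (card (P \<omega> \<inter> (R \<inter> B))))" for B
        using fin[OF that, of B] by (subst emeasure_count_space_finite) (auto simp: ennreal_of_nat_eq_real_of_nat)
      have "(\<Sum>i. emeasure ?Q (P \<omega> \<inter> (R \<inter> Pair y -` A i))) =
          emeasure ?Q (\<Union>i. P \<omega> \<inter> (R \<inter> Pair y -` A i))"
        using union(1) by (intro suminf_emeasure) (auto simp: disjoint_family_on_def)
      moreover have "(\<Union>i. P \<omega> \<inter> (R \<inter> Pair y -` A i)) = P \<omega> \<inter> (R \<inter> Pair y -` (\<Union>i. A i))"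
        by auto
      ultimately show ?thesis by (simp only: card)
    qed
    then have "(\<Sum>i. ennreal (real (case x of (y, \<omega>) \<Rightarrow> card (P \<omega> \<inter> (R \<inter> Pair y -` A i))))) =
        ennreal (real (case x of (y, \<omega>) \<Rightarrow> card (P \<omega> \<inter> (R \<inter> Pair y -` (\<Union>i. A i)))))"
      if "x \<in> space (N \<Otimes>\<^sub>M F)" for x
      using that by (cases x) (simp only: space_pair_measure mem_Sigma_iff prod.case)
    ultimately have "(\<lambda>x. ennreal (real (case x of (y, \<omega>) \<Rightarrow> card (P \<omega> \<inter> (R \<inter> Pair y -` (\<Union>i. A i))))))
        \<in> borel_measurable (N \<Otimes>\<^sub>M F)"
      by (simp only: cong: measurable_cong)
    then have "(\<lambda>x. enn2real (ennreal (real (case x of (y, \<omega>) \<Rightarrow>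
        card (P \<omega> \<inter> (R \<inter> Pair y -` (\<Union>i. A i))))))) \<in> borel_measurable (N \<Otimes>\<^sub>M F)"
      by measurable
    then have "(\<lambda>x. real (case x of (y, \<omega>) \<Rightarrow> card (P \<omega> \<inter> (R \<inter> Pair y -` (\<Union>i. A i)))))
        \<in> borel_measurable (N \<Otimes>\<^sub>M F)"
      by simp
    \<comment> \<open>Rounding carries Borel measurability of the real-valued count back to
      measurability into a discrete space.\<close>
    then have "(\<lambda>x. floor (real (case x of (y, \<omega>) \<Rightarrow> card (P \<omega> \<inter> (R \<inter> Pair y -` (\<Union>i. A i))))))
        \<in> N \<Otimes>\<^sub>M F \<rightarrow>\<^sub>M count_space UNIV"
      by measurable
    then have "(\<lambda>x. nat (floor (real (case x of (y, \<omega>) \<Rightarrow> card (P \<omega> \<inter> (R \<inter> Pair y -` (\<Union>i. A i)))))))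
        \<in> N \<Otimes>\<^sub>M F \<rightarrow>\<^sub>M count_space UNIV"
      by measurable
    then show ?case by simp
  qed
qed

text \<open>Emptiness in an unbounded set is tested on all balls of integer radius. Local finiteness
  rules out that a count of 0 comes from an infinite set, whose \<open>card\<close> is 0.\<close>

lemma pred_count_section_empty:
  assumes lf: "\<And>\<omega>. \<omega> \<in> space M \<Longrightarrow> locally_finite (P \<omega>)"
    and meas: "\<And>B. B \<in> sets borel \<Longrightarrow> bounded B \<Longrightarrow> (\<lambda>\<omega>. card (P \<omega> \<inter> B)) \<in> M \<rightarrow>\<^sub>M count_space UNIV"
    and C: "C \<in> sets (N \<Otimes>\<^sub>M borel)" and Y: "Y \<in> M \<rightarrow>\<^sub>M N"
  shows "Measurable.pred M (\<lambda>\<omega>. P \<omega> \<inter> Pair (Y \<omega>) -` C = {})"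
proof -
  have "(\<lambda>\<omega>. card (P \<omega> \<inter> (ball 0 (real n) \<inter> Pair (Y \<omega>) -` C))) \<in> M \<rightarrow>\<^sub>M count_space UNIV" for n
  proof -
    have "(\<lambda>(y, \<omega>). card (P \<omega> \<inter> (ball 0 (real n) \<inter> Pair y -` C))) \<in> N \<Otimes>\<^sub>M M \<rightarrow>\<^sub>M count_space UNIV"
      by (rule measurable_count_section_bounded[OF lf meas C]) auto
    from measurable_compose[OF _ this, of "\<lambda>\<omega>. (Y \<omega>, \<omega>)" M] Y show ?thesis
      by simp
  qed
  then have "Measurable.pred M (\<lambda>\<omega>. \<forall>n. card (P \<omega> \<inter> (ball 0 (real n) \<inter> Pair (Y \<omega>) -` C)) = 0)"
    by measurable
  moreover have "(\<forall>n. card (P \<omega> \<inter> (ball 0 (real n) \<inter> Pair (Y \<omega>) -` C)) = 0) \<longleftrightarrow>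
      P \<omega> \<inter> Pair (Y \<omega>) -` C = {}" if "\<omega> \<in> space M" for \<omega>
  proof -
    have "finite (P \<omega> \<inter> (ball 0 (real n) \<inter> Pair (Y \<omega>) -` C))" for n
      using lf[OF that] bounded_subset[OF bounded_ball, of _ "0::point" "real n"]
      by (auto simp: locally_finite_def)
    then have "(\<forall>n. card (P \<omega> \<inter> (ball 0 (real n) \<inter> Pair (Y \<omega>) -` C)) = 0) \<longleftrightarrow>
       (\<forall>n::nat. P \<omega> \<inter> (ball 0 (real n) \<inter> Pair (Y \<omega>) -` C) = {})"
      by (simp only: card_0_eq)
    moreover have "\<exists>n::nat. z \<in> ball 0 (real n)" for z :: point
      using reals_Archimedean2[of "norm z"] by auto
    ultimately show ?thesis by blast
  qed
  ultimately show ?thesis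
    by (subst measurable_cong[symmetric]) auto
qed

text \<open>Only countably many index sets are finite, and the event that the true indices form a
  given set is a countable intersection.\<close>

lemma measurable_enat_card:
  assumes [measurable]: "\<And>j::nat. Measurable.pred M (Q j)"
  shows "(\<lambda>\<omega>. if finite {j. Q j \<omega>} then enat (card {j. Q j \<omega>}) else \<infinity>) \<in> M \<rightarrow>\<^sub>M count_space UNIV"
    (is "?f \<in> _")
proof -
  have eq: "Measurable.pred M (\<lambda>\<omega>. {j. Q j \<omega>} = A)" for A
  proof -
    have "Measurable.pred M (\<lambda>\<omega>. \<forall>j. Q j \<omega> \<longleftrightarrow> j \<in> A)" by measurable
    then show ?thesis by (simp add: set_eq_iff)
  qed
  have cn: "Measurable.pred M (\<lambda>\<omega>. ?f \<omega> = enat n)" for n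
  proof -
    have "countable {A :: nat set. finite A \<and> card A = n}"
      by (rule countable_subset[OF _ countable_Collect_finite]) auto
    then have "(\<Union>A\<in>{A. finite A \<and> card A = n}. {\<omega>\<in>space M. {j. Q j \<omega>} = A}) \<in> sets M"
      using eq unfolding pred_def by (intro sets.countable_UN') auto
    also have "(\<Union>A\<in>{A. finite A \<and> card A = n}. {\<omega>\<in>space M. {j. Q j \<omega>} = A}) =
        {\<omega>\<in>space M. finite {j. Q j \<omega>} \<and> card {j. Q j \<omega>} = n}" by auto
    finally have "Measurable.pred M (\<lambda>\<omega>. finite {j. Q j \<omega>} \<and> card {j. Q j \<omega>} = n)"
      by (simp add: pred_def)
    then show ?thesis
      by (rule measurable_cong[THEN iffD1, rotated]) auto
  qed
  then have "Measurable.pred M (\<lambda>\<omega>. \<forall>n. ?f \<omega> \<noteq> enat n)" by measurable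
  then have ci: "Measurable.pred M (\<lambda>\<omega>. ?f \<omega> = \<infinity>)"
    by (rule measurable_cong[THEN iffD1, rotated]) (auto split: if_splits)
  show ?thesis
  proof (subst measurable_count_space_eq2_countable, intro conjI ballI)
    fix a :: enat
    have "Measurable.pred M (\<lambda>\<omega>. ?f \<omega> = a)" using cn ci by (cases a) auto
    then have "{\<omega>\<in>space M. ?f \<omega> = a} \<in> sets M" by (simp add: pred_def)
    then show "?f -` {a} \<inter> space M \<in> sets M"
      by (rule back_subst[where P = "\<lambda>A. A \<in> sets M"]) auto
  qed auto
qed

section \<open>Poisson point processes and independence\<close>

lemma poisson_point_process_locally_finite:
  "poisson_point_process M lam P \<Longrightarrow> \<omega> \<in> space M \<Longrightarrow> locally_finite (P \<omega>)"
  by (simp add: poisson_point_process_def locally_finite_def)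

lemma poisson_point_process_measurable:
  "poisson_point_process M lam P \<Longrightarrow> B \<in> sets borel \<Longrightarrow> bounded B \<Longrightarrow>
    (\<lambda>\<omega>. card (P \<omega> \<inter> B)) \<in> M \<rightarrow>\<^sub>M count_space UNIV"
  by (simp add: poisson_point_process_def)

lemma poisson_point_process_prob:
  "poisson_point_process M lam P \<Longrightarrow> B \<in> sets borel \<Longrightarrow> bounded B \<Longrightarrow>
    measure M {\<omega>\<in>space M. card (P \<omega> \<inter> B) = k} =
      (lam * measure lborel B) ^ k / fact k * exp (- (lam * measure lborel B))"
  by (simp add: poisson_point_process_def)

text \<open>The embedding \<open>e\<close> lets one statement serve both for counts in the naturals
  and, with \<open>e = enat\<close>, for the out-degree, whose infinite value \<open>f\<close> sends
  to 0.\<close>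

lemma (in prob_space) pgf_sums:
  fixes f :: "'b \<Rightarrow> real" and e :: "nat \<Rightarrow> 'b"
  assumes [measurable]: "N \<in> M \<rightarrow>\<^sub>M count_space UNIV" and "inj e"
    and s: "0 \<le> s" "s < 1"
    and f: "\<And>n. f (e n) = s ^ n" "\<And>y. y \<notin> range e \<Longrightarrow> f y = 0"
  shows "(\<lambda>n. prob {\<omega>\<in>space M. N \<omega> = e n} * s ^ n) sums (\<integral>\<omega>. f (N \<omega>) \<partial>M)"
proof -
  define A where "A n = {\<omega>\<in>space M. N \<omega> = e n}" for n
  have A[measurable]: "A n \<in> events" for n unfolding A_def by measurable
  let ?g = "\<lambda>n \<omega>. s ^ n * indicator (A n) \<omega> :: real"
  have int: "(\<integral>\<omega>. ?g n \<omega> \<partial>M) = prob (A n) * s ^ n" for n by simp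
  have g_sums: "(\<lambda>n. ?g n \<omega>) sums f (N \<omega>)" if "\<omega> \<in> space M" for \<omega>
  proof (cases "N \<omega> \<in> range e")
    case True
    then obtain n where n: "N \<omega> = e n" by auto
    then have "?g m \<omega> = (if m = n then s ^ m else 0)" for m
      using that \<open>inj e\<close> by (auto simp: A_def indicator_def inj_eq)
    then show ?thesis using n f(1) sums_single[of n "\<lambda>m. s ^ m"] by simp
  next
    case False
    then have "?g m \<omega> = 0" for m by (auto simp: A_def indicator_def)
    then show ?thesis by (simp only: f(2)[OF False] sums_zero)
  qed
  have "(\<lambda>n. \<integral>\<omega>. ?g n \<omega> \<partial>M) sums (\<integral>\<omega>. (\<Sum>n. ?g n \<omega>) \<partial>M)"
  proof (rule sums_integral)
    show "integrable M (?g n)" for n 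
      by (intro integrable_mult_right integrable_real_indicator) (auto simp: less_top[symmetric])
    show "AE \<omega> in M. summable (\<lambda>n. norm (?g n \<omega>))"
      using g_sums s by (intro AE_I2) (auto simp: sums_iff abs_mult)
    show "summable (\<lambda>n. \<integral>\<omega>. norm (?g n \<omega>) \<partial>M)"
    proof (rule summable_comparison_test')
      show "summable (\<lambda>n. s ^ n)" using s by (simp add: summable_geometric)
      show "norm (\<integral>\<omega>. norm (?g n \<omega>) \<partial>M) \<le> s ^ n" for n
        using s by (simp add: abs_mult mult_left_le)
    qed
  qed
  moreover have "(\<integral>\<omega>. (\<Sum>n. ?g n \<omega>) \<partial>M) = (\<integral>\<omega>. f (N \<omega>) \<partial>M)"
    by (intro Bochner_Integration.integral_cong) (use g_sums in \<open>auto simp: sums_iff\<close>)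
  ultimately show ?thesis unfolding int by (simp only: A_def)
qed

lemma (in prob_space) poisson_pgf:
  assumes N: "N \<in> M \<rightarrow>\<^sub>M count_space (UNIV :: nat set)"
    and poisson: "\<And>k. prob {\<omega>\<in>space M. N \<omega> = k} = \<mu> ^ k / fact k * exp (- \<mu>)"
    and s: "0 \<le> s" "s \<le> 1"
  shows "(\<integral>\<omega>. s ^ N \<omega> \<partial>M) = exp (- (\<mu> * (1 - s)))"
\<comment> \<open>At 1 the integral is the total mass; \<open>pgf_sums\<close> covers the values
  below 1.\<close>
proof (cases "s = 1")
  case True
  then show ?thesis by (simp add: prob_space)
next
  case False
  have "(\<lambda>n. (\<mu> ^ n / fact n * exp (- \<mu>)) * s ^ n) sums (\<integral>\<omega>. s ^ N \<omega> \<partial>M)"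
    using pgf_sums[OF N, of "\<lambda>n. n" s "\<lambda>n. s ^ n"] False s by (simp add: poisson)
  moreover have "(\<lambda>n. exp (- \<mu>) * ((\<mu> * s) ^ n /\<^sub>R fact n)) sums (exp (- \<mu>) * exp (\<mu> * s))"
    by (intro sums_mult exp_converges)
  moreover have "exp (- \<mu>) * ((\<mu> * s) ^ n /\<^sub>R fact n) = (\<mu> ^ n / fact n * exp (- \<mu>)) * s ^ n" for n
    by (simp add: power_mult_distrib divide_inverse)
  ultimately have "(\<integral>\<omega>. s ^ N \<omega> \<partial>M) = exp (- \<mu>) * exp (\<mu> * s)"
    using sums_unique2 by fastforce
  then show ?thesis by (simp add: algebra_simps flip: exp_add)
qed

text \<open>The definition of a Poisson process gives independence for families indexed by an
  initial segment of the naturals, whereas cells are indexed by pairs.\<close>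

lemma (in prob_space) indep_sets_reindex:
  assumes ind: "indep_sets (\<lambda>j. F (h j)) J" and inj: "inj_on h J"
  shows "indep_sets F (h ` J)"
proof (rule indep_setsI)
  show "F i \<subseteq> events" if "i \<in> h ` J" for i
    using ind that by (auto simp: indep_sets_def)
next
  fix A K assume K: "K \<noteq> {}" "K \<subseteq> h ` J" "finite K" "\<forall>j\<in>K. A j \<in> F j"
  define K' where "K' = {j\<in>J. h j \<in> K}"
  have hK: "K = h ` K'" and injK: "inj_on h K'" and sub: "K' \<subseteq> J"
    using K(2) inj by (auto simp: K'_def inj_on_def)
  have "finite K'" "K' \<noteq> {}" using K(1,3) injK unfolding hK by (auto dest: finite_imageD)
  then have "prob (\<Inter>j\<in>K'. A (h j)) = (\<Prod>j\<in>K'. prob (A (h j)))"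
    using K(4) sub hK by (intro indep_setsD[OF ind]) auto
  then show "prob (\<Inter>j\<in>K. A j) = (\<Prod>j\<in>K. prob (A j))"
    unfolding hK by (simp add: prod.reindex[OF injK])
qed

lemma (in prob_space) poisson_point_process_indep:
  assumes ppp: "poisson_point_process M lam P" and "finite I"
    and B: "\<And>i. i \<in> I \<Longrightarrow> B i \<in> sets borel" "\<And>i. i \<in> I \<Longrightarrow> bounded (B i)"
    and disj: "disjoint_family_on B I"
  shows "indep_vars (\<lambda>_. count_space UNIV) (\<lambda>i \<omega>. card (P \<omega> \<inter> B i)) I"
proof -
  obtain h where h: "bij_betw h {..<card I} I"
    using ex_bij_betw_nat_finite[OF \<open>finite I\<close>] by (auto simp: atLeast0LessThan)
  have hI: "h ` {..<card I} = I" and inj: "inj_on h {..<card I}"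
    using h by (auto simp: bij_betw_def)
  have "indep_vars (\<lambda>_. count_space UNIV) (\<lambda>i \<omega>. card (P \<omega> \<inter> B (h i))) {..<card I}"
  proof -
    have "disjoint_family_on (\<lambda>i. B (h i)) {..<card I}"
      using disj inj hI unfolding disjoint_family_on_def inj_on_def by blast
    moreover have "\<forall>i<card I. B (h i) \<in> sets borel \<and> bounded (B (h i))"
      using B hI by blast
    ultimately show ?thesis
      using ppp[unfolded poisson_point_process_def, THEN conjunct2, THEN conjunct2, rule_format,
          of "card I" "\<lambda>i. B (h i)"] by simp
  qed
  then have "indep_vars (\<lambda>_. count_space UNIV) (\<lambda>i \<omega>. card (P \<omega> \<inter> B i)) (h ` {..<card I})"
    unfolding indep_vars_def2 by (auto intro: indep_sets_reindex[OF _ inj])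
  then show ?thesis by (simp only: hI)
qed

text \<open>Each function generates a sigma-algebra inside the one for which it is measurable, so
  independence passes to the functions; boundedness makes them integrable.\<close>

lemma (in prob_space) indep_set_integral_mult:
  fixes f g :: "'a \<Rightarrow> real"
  assumes ind: "indep_set (sigma_sets (space M) A) (sigma_sets (space M) B)"
    and f: "f \<in> borel_measurable (sigma (space M) A)" and g: "g \<in> borel_measurable (sigma (space M) B)"
    and bnd: "\<And>\<omega>. \<omega> \<in> space M \<Longrightarrow> \<bar>f \<omega>\<bar> \<le> c" "\<And>\<omega>. \<omega> \<in> space M \<Longrightarrow> \<bar>g \<omega>\<bar> \<le> c"
  shows "(\<integral>\<omega>. f \<omega> * g \<omega> \<partial>M) = (\<integral>\<omega>. f \<omega> \<partial>M) * (\<integral>\<omega>. g \<omega> \<partial>M)"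
proof -
  have ev: "sigma_sets (space M) A \<subseteq> events" "sigma_sets (space M) B \<subseteq> events"
    using ind by (simp_all add: indep_sets2_eq)
  have Pow: "A \<subseteq> Pow (space M)" "B \<subseteq> Pow (space M)"
    using ev sets.space_closed[of M] by (meson order_trans sigma_sets_superset_generator)+
  have sub: "{h -` X \<inter> space M | X. X \<in> sets borel} \<subseteq> sigma_sets (space M) C"
    if "h \<in> borel_measurable (sigma (space M) C)" "C \<subseteq> Pow (space M)" for h :: "'a \<Rightarrow> real" and C
    using measurable_sets[OF that(1)] that(2) by (auto simp: sets_measure_of space_measure_of)
  have rv: "random_variable borel f" "random_variable borel g"
    using sub[OF f Pow(1)] sub[OF g Pow(2)] ev by (auto simp: measurable_def)
  have "indep_var borel f borel g"
    unfolding indep_var_eq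
  proof (intro conjI rv)
    show "indep_set (sigma_sets (space M) {f -` X \<inter> space M | X. X \<in> sets borel})
        (sigma_sets (space M) {g -` X \<inter> space M | X. X \<in> sets borel})"
      using ind sigma_sets_subseteq[OF sub[OF f Pow(1)], of "space M"]
        sigma_sets_subseteq[OF sub[OF g Pow(2)], of "space M"]
      unfolding indep_set_def
      by (elim indep_sets_mono_sets) (auto simp: sigma_sets_sigma_sets_eq Pow split: bool.split)
  qed
  moreover have "integrable M f" "integrable M g"
    using rv bnd by (auto intro!: integrable_const_bound[where B = c])
  ultimately show ?thesis by (rule indep_var_lebesgue_integral)
qed

text \<open>\<open>indep_var\<close> needs a common codomain type, so the product law of \<open>Y\<close> and the identity is
  derived from independence of the generated \<open>\<sigma>\<close>-algebras.\<close>

lemma (in prob_space) indep_integral_const: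
  fixes Z :: "'b \<times> 'a \<Rightarrow> real"
  assumes ind: "indep_set (sigma_sets (space M) {Y -` X \<inter> space M | X. X \<in> sets N}) (sigma_sets (space M) B)"
    and Y: "random_variable N Y"
    and Z: "Z \<in> borel_measurable (N \<Otimes>\<^sub>M sigma (space M) B)"
    and bnd: "\<And>y \<omega>. y \<in> space N \<Longrightarrow> \<omega> \<in> space M \<Longrightarrow> \<bar>Z (y, \<omega>)\<bar> \<le> b"
    and const: "\<And>y. y \<in> space N \<Longrightarrow> (\<integral>\<omega>. Z (y, \<omega>) \<partial>M) = c"
  shows "integrable M (\<lambda>\<omega>. Z (Y \<omega>, \<omega>))" "(\<integral>\<omega>. Z (Y \<omega>, \<omega>) \<partial>M) = c"
proof -
  define F where "F = sigma (space M) B"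
  have ev: "sigma_sets (space M) B \<subseteq> events"
    using ind by (simp add: indep_sets2_eq)
  have Pow: "B \<subseteq> Pow (space M)"
    using ev sets.space_closed[of M] by (meson order_trans sigma_sets_superset_generator)
  have sF: "sets F = sigma_sets (space M) B" "space F = space M"
    using Pow by (simp_all add: F_def sets_measure_of space_measure_of)
  \<comment> \<open>The identity into the coarser space \<open>F\<close> is the second random
    element; \<open>F\<close> replaces the full event algebra because \<open>Y\<close> is known to
    be independent only of \<open>F\<close>.\<close>
  have id: "random_variable F (\<lambda>\<omega>. \<omega>)"
    using ev sF by (auto simp: measurable_def Int_absorb2 sets.sets_into_space)
  have pair: "random_variable (N \<Otimes>\<^sub>M F) (\<lambda>\<omega>. (Y \<omega>, \<omega>))"
    using Y id by measurable
  have Z': "Z \<in> borel_measurable (N \<Otimes>\<^sub>M F)" using Z by (simp add: F_def)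
  interpret D1: prob_space "distr M N Y" by (rule prob_space_distr[OF Y])
  interpret D2: prob_space "distr M F (\<lambda>\<omega>. \<omega>)" by (rule prob_space_distr[OF id])
  interpret D: pair_prob_space "distr M N Y" "distr M F (\<lambda>\<omega>. \<omega>)" ..
  have distr: "distr M N Y \<Otimes>\<^sub>M distr M F (\<lambda>\<omega>. \<omega>) = distr M (N \<Otimes>\<^sub>M F) (\<lambda>\<omega>. (Y \<omega>, \<omega>))"
  proof (rule pair_measure_eqI)
    show "sigma_finite_measure (distr M N Y)" ..
    show "sigma_finite_measure (distr M F (\<lambda>\<omega>. \<omega>))" ..
    fix A C assume "A \<in> sets (distr M N Y)" and "C \<in> sets (distr M F (\<lambda>\<omega>. \<omega>))"
    then have A: "A \<in> sets N" and C: "C \<in> sets F" by simp_all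
    have "C \<subseteq> space M" using sets.sets_into_space[OF C] sF by simp
    then have eq: "(\<lambda>\<omega>. (Y \<omega>, \<omega>)) -` (A \<times> C) \<inter> space M = (Y -` A \<inter> space M) \<inter> C"
      "(\<lambda>\<omega>. \<omega>) -` C \<inter> space M = C" by auto
    have "prob ((Y -` A \<inter> space M) \<inter> C) = prob (Y -` A \<inter> space M) * prob C"
      using ind A C sF unfolding indep_sets2_eq by blast
    then show "emeasure (distr M N Y) A * emeasure (distr M F (\<lambda>\<omega>. \<omega>)) C =
        emeasure (distr M (N \<Otimes>\<^sub>M F) (\<lambda>\<omega>. (Y \<omega>, \<omega>))) (A \<times> C)"
      using A C Y id pair
      by (simp add: emeasure_distr eq emeasure_eq_measure ennreal_mult[symmetric] del: vimage_ident)
  qed simp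
  have meas_comp: "(\<lambda>\<omega>. Z (Y \<omega>, \<omega>)) \<in> borel_measurable M"
    using measurable_compose[OF pair Z'] by simp
  show int: "integrable M (\<lambda>\<omega>. Z (Y \<omega>, \<omega>))"
    using bnd measurable_space[OF Y] meas_comp by (intro integrable_const_bound[where B = b]) auto
  have intD: "integrable (distr M N Y \<Otimes>\<^sub>M distr M F (\<lambda>\<omega>. \<omega>)) Z"
    unfolding distr using int Z' pair by (simp add: integrable_distr_eq)
  have "(\<integral>\<omega>. Z (Y \<omega>, \<omega>) \<partial>M) = (\<integral>p. Z p \<partial>distr M (N \<Otimes>\<^sub>M F) (\<lambda>\<omega>. (Y \<omega>, \<omega>)))"
    using Z' pair by (simp add: integral_distr)
  also have "\<dots> = (\<integral>y. (\<integral>\<omega>. Z (y, \<omega>) \<partial>distr M F (\<lambda>\<omega>. \<omega>)) \<partial>distr M N Y)"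
    unfolding distr[symmetric] by (rule D.integral_fst'[OF intD, symmetric])
  \<comment> \<open>The inner integral is the constant \<open>c\<close>, so the law of
    \<open>Y\<close> enters only through its total mass.\<close>
  also have "\<dots> = (\<integral>y. c \<partial>distr M N Y)"
  proof (rule Bochner_Integration.integral_cong[OF refl])
    fix y assume "y \<in> space (distr M N Y)"
    then have y: "y \<in> space N" by simp
    then have "(\<integral>\<omega>. Z (y, \<omega>) \<partial>distr M F (\<lambda>\<omega>. \<omega>)) = (\<integral>\<omega>. Z (y, \<omega>) \<partial>M)"
      using measurable_Pair2[OF Z'] id by (intro integral_distr) auto
    then show "(\<integral>\<omega>. Z (y, \<omega>) \<partial>distr M F (\<lambda>\<omega>. \<omega>)) = c" using const[OF y] by simp
  qed
  also have "\<dots> = c" using D1.prob_space by simp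
  finally show "(\<integral>\<omega>. Z (Y \<omega>, \<omega>) \<partial>M) = c" .
qed

section \<open>Bounding the out-degree by cell counts\<close>

definition cell :: "nat \<Rightarrow> real \<Rightarrow> real \<Rightarrow> nat \<Rightarrow> nat \<Rightarrow> point set" where
  "cell L h \<phi> l j = annulus (h * real j) (h * real (Suc j)) \<inter> sector L 0 \<phi> l"

lemma cell_borel: "1 \<le> L \<Longrightarrow> cell L h \<phi> l j \<in> sets borel"
  unfolding cell_def using borel_open[OF open_sector] by (intro sets.Int annulus_borel) auto

lemma bounded_cell: "bounded (cell L h \<phi> l j)"
  unfolding cell_def using bounded_annulus by (rule bounded_subset) auto

text \<open>The area depends on neither the shell, the sector nor the offset: this makes the sums
  below geometric and the expectations the same for every fixed offset.\<close>

lemma measure_cell: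
  assumes "1 \<le> L" "0 < h" "l \<in> {1..L}"
  shows "measure lborel (cell L h \<phi> l j) = pi * h / real L"
proof -
  have "h * real j \<le> h * real (Suc j)" using assms by simp
  then have "measure lborel (sector L 0 \<phi> l \<inter> annulus (h * real j) (h * real (Suc j))) =
      pi * (h * real (Suc j) - h * real j) / real L"
    using assms by (intro measure_sector_annulus) auto
  then show ?thesis
    by (simp add: cell_def Int_commute algebra_simps)
qed

lemma annulus_index:
  assumes "0 < h"
  shows "\<exists>j. z \<in> annulus (h * real j) (h * real (Suc j))"
proof -
  define x where "x = (norm z)\<^sup>2 / h"
  have "x \<ge> 0" using assms by (simp add: x_def)
  define n where "n = nat \<lfloor>x\<rfloor>"
  have "real n \<le> x" "x < real (Suc n)"
    using \<open>x \<ge> 0\<close> unfolding n_def by linarith+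
  then have "z \<in> annulus (h * real n) (h * real (Suc n))"
    using assms
    by (simp add: annulus_def x_def pos_le_divide_eq pos_divide_less_eq mult.commute del: of_nat_Suc)
  then show ?thesis by blast
qed

text \<open>Half-open shells make the comparison strict between different shells and say nothing
  within one, which is why the shell of the first eavesdropper stays undecided.\<close>

lemma annulus_less:
  assumes "0 < h" "z \<in> annulus (h * real j) (h * real (Suc j))"
    "e \<in> annulus (h * real k) (h * real (Suc k))" "j < k"
  shows "norm z < norm e"
proof -
  have "(norm z)\<^sup>2 < h * real (Suc j)" "h * real k \<le> (norm e)\<^sup>2"
    using assms by (auto simp: annulus_def)
  moreover have "h * real (Suc j) \<le> h * real k"
    using assms by (intro mult_left_mono) auto
  ultimately have "(norm z)\<^sup>2 < (norm e)\<^sup>2" by linarith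
  then show ?thesis by (rule power_less_imp_less_base) simp
qed

lemma disjoint_cells:
  assumes "0 < h"
  shows "disjoint_family_on (\<lambda>(l, j). cell L h \<phi> l j) ({1..L} \<times> UNIV)"
proof -
  have "cell L h \<phi> l j \<inter> cell L h \<phi> l' j' = {}"
    if ll: "l \<in> {1..L}" "l' \<in> {1..L}" "(l, j) \<noteq> (l', j')" for l l' j j'
  proof (cases "l = l'")
    case True
    have "z \<notin> cell L h \<phi> l' j'" if z: "z \<in> cell L h \<phi> l j" for z
    proof
      assume "z \<in> cell L h \<phi> l' j'"
      moreover have "j < j' \<or> j' < j" using ll(3) True by auto
      ultimately show False
        using z annulus_less[OF assms, of z j z j'] annulus_less[OF assms, of z j' z j]
        by (auto simp: cell_def)
    qed
    then show ?thesis by blast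
  next
    case False
    then show ?thesis using sector_disjoint[OF ll(1,2)] by (auto simp: cell_def)
  qed
  then show ?thesis unfolding disjoint_family_on_def by auto
qed

text \<open>In the following, \<open>X l j\<close> and \<open>Y l j\<close> stand for the numbers of legitimate nodes and of
  eavesdroppers in cell \<open>j\<close> of sector \<open>l\<close>, and only the first \<open>K\<close> cells of each sector are looked at.
  The cell \<open>\<kappa> l\<close> itself is left out of the count of legitimate nodes for \<open>c = 0\<close>, which gives a lower
  bound on the out-degree, and included for \<open>c = 1\<close>, which gives an upper bound.\<close>

definition first_cell :: "nat \<Rightarrow> (nat \<Rightarrow> nat \<Rightarrow> nat) \<Rightarrow> (nat \<Rightarrow> nat) \<Rightarrow> bool" where
  "first_cell L Y \<kappa> \<longleftrightarrow> (\<forall>l\<in>{1..L}. (\<forall>j<\<kappa> l. Y l j = 0) \<and> Y l (\<kappa> l) \<noteq> 0)"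

definition legit_weight :: "nat \<Rightarrow> nat \<Rightarrow> nat \<Rightarrow> real \<Rightarrow> (nat \<Rightarrow> nat \<Rightarrow> nat) \<Rightarrow> (nat \<Rightarrow> nat) \<Rightarrow> real" where
  "legit_weight L K c s X \<kappa> =
     (\<Prod>(l, j)\<in>{1..L} \<times> {..<K}. (if j < \<kappa> l + c then s else 1) ^ X l j)"

definition eaves_weight :: "nat \<Rightarrow> nat \<Rightarrow> (nat \<Rightarrow> nat \<Rightarrow> nat) \<Rightarrow> (nat \<Rightarrow> nat) \<Rightarrow> real" where
  "eaves_weight L K Y \<kappa> =
     (\<Prod>(l, j)\<in>{1..L} \<times> {..<K}. if j < \<kappa> l then of_bool (Y l j = 0)
        else if j = \<kappa> l then 1 - of_bool (Y l j = 0) else 1)"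

definition sandwich :: "nat \<Rightarrow> nat \<Rightarrow> nat \<Rightarrow> real \<Rightarrow> (nat \<Rightarrow> nat \<Rightarrow> nat) \<Rightarrow> (nat \<Rightarrow> nat \<Rightarrow> nat) \<Rightarrow> real" where
  "sandwich L K c s X Y =
     (\<Sum>\<kappa>\<in>{1..L} \<rightarrow>\<^sub>E {..<K}. legit_weight L K c s X \<kappa> * eaves_weight L K Y \<kappa>)"

lemma legit_weight_bounds:
  assumes "0 \<le> s" "s \<le> 1"
  shows "0 \<le> legit_weight L K c s X \<kappa>" "legit_weight L K c s X \<kappa> \<le> 1"
  using assms by (auto simp: legit_weight_def split_beta intro!: prod_nonneg prod_le_1 power_le_one)

text \<open>A value \<open>\<kappa> l\<close> below \<open>K\<close> puts the cell
  \<open>\<kappa> l\<close> itself among the factors, so the product detects both an earlier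
  occupied cell and an empty cell \<open>\<kappa> l\<close>.\<close>

lemma eaves_weight_eq:
  assumes "\<kappa> \<in> {1..L} \<rightarrow>\<^sub>E {..<K}"
  shows "eaves_weight L K Y \<kappa> = of_bool (first_cell L Y \<kappa>)"
proof (cases "first_cell L Y \<kappa>")
  case True
  then have "eaves_weight L K Y \<kappa> = 1"
    unfolding eaves_weight_def by (intro prod.neutral) (auto simp: first_cell_def)
  then show ?thesis using True by simp
next
  case False
  then obtain l where l: "l \<in> {1..L}" and "(\<exists>j<\<kappa> l. Y l j \<noteq> 0) \<or> Y l (\<kappa> l) = 0"
    unfolding first_cell_def by blast
  then obtain j where j: "j < \<kappa> l \<and> Y l j \<noteq> 0 \<or> j = \<kappa> l \<and> Y l j = 0"
    by blast
  moreover have "\<kappa> l < K" using PiE_mem[OF assms l] by simp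
  ultimately have "(l, j) \<in> {1..L} \<times> {..<K}"
    using l by auto
  then have "eaves_weight L K Y \<kappa> = 0"
    unfolding eaves_weight_def using j by (intro prod_zero bexI[of _ "(l, j)"]) auto
  then show ?thesis using False by simp
qed

lemma first_cell_unique:
  assumes "first_cell L Y \<kappa>" "first_cell L Y \<kappa>'"
    "\<kappa> \<in> {1..L} \<rightarrow>\<^sub>E {..<K}" "\<kappa>' \<in> {1..L} \<rightarrow>\<^sub>E {..<K}"
  shows "\<kappa> = \<kappa>'"
proof (rule PiE_ext[OF assms(3,4)])
  fix l assume "l \<in> {1..L}"
  note first = assms(1,2)[unfolded first_cell_def, THEN bspec, OF this]
  have "\<not> \<kappa>' l < \<kappa> l" "\<not> \<kappa> l < \<kappa>' l"
    using first(1)[THEN conjunct1, rule_format, of "\<kappa>' l"] first(1)[THEN conjunct2]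
      first(2)[THEN conjunct1, rule_format, of "\<kappa> l"] first(2)[THEN conjunct2] by linarith+
  then show "\<kappa> l = \<kappa>' l" by simp
qed

text \<open>At most one summand of \<^const>\<open>sandwich\<close> is nonzero; the sum over \<open>\<kappa>\<close> is there because each
  summand is a product over the cells and hence has an expectation that factorises.\<close>

lemma sandwich_eq:
  assumes "first_cell L Y \<kappa>" "\<kappa> \<in> {1..L} \<rightarrow>\<^sub>E {..<K}"
  shows "sandwich L K c s X Y = legit_weight L K c s X \<kappa>"
proof -
  have "sandwich L K c s X Y = (\<Sum>\<kappa>'\<in>{1..L} \<rightarrow>\<^sub>E {..<K}. if \<kappa>' = \<kappa> then legit_weight L K c s X \<kappa>' else 0)"
    unfolding sandwich_def
  proof (rule sum.cong[OF refl])
    fix \<kappa>' assume \<kappa>': "\<kappa>' \<in> {1..L} \<rightarrow>\<^sub>E {..<K}"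
    have "first_cell L Y \<kappa>' \<longleftrightarrow> \<kappa>' = \<kappa>"
      using first_cell_unique[OF _ assms(1) \<kappa>' assms(2)] assms(1) by blast
    then show "legit_weight L K c s X \<kappa>' * eaves_weight L K Y \<kappa>' =
        (if \<kappa>' = \<kappa> then legit_weight L K c s X \<kappa>' else 0)"
      by (simp add: eaves_weight_eq[OF \<kappa>'])
  qed
  also have "\<dots> = legit_weight L K c s X \<kappa>"
    using assms(2) by (simp add: sum.delta finite_PiE)
  finally show ?thesis .
qed

lemma sandwich_eq_0:
  assumes "\<not> (\<exists>\<kappa>\<in>{1..L} \<rightarrow>\<^sub>E {..<K}. first_cell L Y \<kappa>)"
  shows "sandwich L K c s X Y = 0"
  unfolding sandwich_def
proof (rule sum.neutral, rule ballI)
  fix \<kappa> assume "\<kappa> \<in> {1..L} \<rightarrow>\<^sub>E {..<K}"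
  then show "legit_weight L K c s X \<kappa> * eaves_weight L K Y \<kappa> = 0"
    using assms eaves_weight_eq by simp
qed

lemma sandwich_bounds:
  assumes "0 \<le> s" "s \<le> 1"
  shows "0 \<le> sandwich L K c s X Y" "sandwich L K c s X Y \<le> 1"
proof -
  have "0 \<le> sandwich L K c s X Y \<and> sandwich L K c s X Y \<le> 1"
  proof (cases "\<exists>\<kappa>\<in>{1..L} \<rightarrow>\<^sub>E {..<K}. first_cell L Y \<kappa>")
    case True
    then obtain \<kappa> where "\<kappa> \<in> {1..L} \<rightarrow>\<^sub>E {..<K}" "first_cell L Y \<kappa>" by blast
    then show ?thesis using legit_weight_bounds[OF assms] by (simp only: sandwich_eq)
  next
    case False
    then show ?thesis by (simp add: sandwich_eq_0)
  qed
  then show "0 \<le> sandwich L K c s X Y" "sandwich L K c s X Y \<le> 1" by auto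
qed

lemma legit_weight_eq:
  assumes "\<kappa> \<in> {1..L} \<rightarrow>\<^sub>E {..<K}" "c \<le> 1"
  shows "legit_weight L K c s X \<kappa> = s ^ (\<Sum>l\<in>{1..L}. \<Sum>j<\<kappa> l + c. X l j)"
proof -
  have "legit_weight L K c s X \<kappa> = (\<Prod>l\<in>{1..L}. \<Prod>j<K. (if j < \<kappa> l + c then s else 1) ^ X l j)"
    by (simp add: legit_weight_def prod.cartesian_product)
  also have "\<dots> = (\<Prod>l\<in>{1..L}. \<Prod>j<\<kappa> l + c. s ^ X l j)"
  proof (rule prod.cong[OF refl])
    fix l assume "l \<in> {1..L}"
    \<comment> \<open>Since \<open>\<kappa> l < K\<close>, adding at most one cell stays within the
      truncation.\<close>
    then have "\<kappa> l + c \<le> K" using PiE_mem[OF assms(1)] assms(2) by fastforce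
    then show "(\<Prod>j<K. (if j < \<kappa> l + c then s else 1) ^ X l j) = (\<Prod>j<\<kappa> l + c. s ^ X l j)"
      by (intro prod.mono_neutral_cong_right) auto
  qed
  finally show ?thesis by (simp add: power_sum)
qed

section \<open>Out-neighbours of the typical node against cell counts\<close>

text \<open>A set of points instead of node indices, so that it can be compared with counts; being
  nearer than every eavesdropper of the sector replaces being nearer than the closest one.\<close>

definition iS_neighbors :: "nat \<Rightarrow> real \<Rightarrow> point set \<Rightarrow> point set \<Rightarrow> point set" where
  "iS_neighbors L \<phi> P E =
     {y\<in>P. \<exists>l\<in>{1..L}. y \<in> sector L 0 \<phi> l \<and> (\<forall>e\<in>E \<inter> sector L 0 \<phi> l. norm y < norm e)}"

text \<open>Eavesdroppers of sector \<open>l\<close> lie in cell \<open>\<kappa> l\<close> or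
  farther out, so a node in an earlier cell beats all of them; one of them does lie in cell
  \<open>\<kappa> l\<close>, so no node beyond that cell is a neighbour. Hence the neighbours lie
  between the unions \<open>U 0\<close> and \<open>U 1\<close>.\<close>

lemma iS_neighbors_card_bounds:
  assumes "0 < h" and P: "locally_finite P"
    and first: "first_cell L (\<lambda>l j. card (E \<inter> cell L h \<phi> l j)) \<kappa>" and E: "locally_finite E"
  shows "finite (iS_neighbors L \<phi> P E)"
    "(\<Sum>l\<in>{1..L}. \<Sum>j<\<kappa> l. card (P \<inter> cell L h \<phi> l j)) \<le> card (iS_neighbors L \<phi> P E)"
    "card (iS_neighbors L \<phi> P E) \<le> (\<Sum>l\<in>{1..L}. \<Sum>j<\<kappa> l + 1. card (P \<inter> cell L h \<phi> l j))"
proof -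
  have fin: "finite (X \<inter> cell L h \<phi> l j)" if "locally_finite X" for X l j
    using that bounded_cell by (simp add: locally_finite_def)
  define U where "U c = (\<Union>(l, j)\<in>(SIGMA l:{1..L}. {..<\<kappa> l + c}). P \<inter> cell L h \<phi> l j)" for c
  have finU: "finite (U c)" for c
    unfolding U_def using fin[OF P] by auto
  have cardU: "card (U c) = (\<Sum>l\<in>{1..L}. \<Sum>j<\<kappa> l + c. card (P \<inter> cell L h \<phi> l j))" for c
  proof -
    have "card (U c) = (\<Sum>(l, j)\<in>(SIGMA l:{1..L}. {..<\<kappa> l + c}). card (P \<inter> cell L h \<phi> l j))"
      unfolding U_def split_beta
    proof (intro card_UN_disjoint ballI impI)
      fix p q assume pq: "p \<in> (SIGMA l:{1..L}. {..<\<kappa> l + c})" "q \<in> (SIGMA l:{1..L}. {..<\<kappa> l + c})" "p \<noteq> q"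
      then have "(case p of (l, j) \<Rightarrow> cell L h \<phi> l j) \<inter> (case q of (l, j) \<Rightarrow> cell L h \<phi> l j) = {}"
        by (intro disjoint_family_onD[OF disjoint_cells[OF \<open>0 < h\<close>, of L \<phi>]]) auto
      then show "(P \<inter> cell L h \<phi> (fst p) (snd p)) \<inter> (P \<inter> cell L h \<phi> (fst q) (snd q)) = {}"
        by (auto simp: split_beta)
    qed (use fin[OF P] in auto)
    then show ?thesis by (simp add: sum.Sigma)
  qed
  have empty: "E \<inter> cell L h \<phi> l j = {}" if "l \<in> {1..L}" "j < \<kappa> l" for l j
  proof -
    have "card (E \<inter> cell L h \<phi> l j) = 0" using first that by (simp add: first_cell_def)
    then show ?thesis by (simp only: card_0_eq[OF fin[OF E]])
  qed
  have nonempty: "E \<inter> cell L h \<phi> l (\<kappa> l) \<noteq> {}" if "l \<in> {1..L}" for l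
  proof -
    have "card (E \<inter> cell L h \<phi> l (\<kappa> l)) \<noteq> 0" using first that by (simp add: first_cell_def)
    then show ?thesis by (metis card.empty)
  qed
  have sub1: "U 0 \<subseteq> iS_neighbors L \<phi> P E"
  proof
    fix y assume "y \<in> U 0"
    then obtain l j where y: "l \<in> {1..L}" "j < \<kappa> l" "y \<in> P" "y \<in> cell L h \<phi> l j"
      by (auto simp: U_def)
    have "norm y < norm e" if e: "e \<in> E \<inter> sector L 0 \<phi> l" for e
    proof -
      obtain k where k: "e \<in> annulus (h * real k) (h * real (Suc k))"
        using annulus_index[OF \<open>0 < h\<close>] by blast
      then have "e \<in> E \<inter> cell L h \<phi> l k" using e by (auto simp: cell_def)
      then have "\<not> k < \<kappa> l" using empty[OF y(1)] by blast
      then show ?thesis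
        using annulus_less[OF \<open>0 < h\<close> _ k] y by (auto simp: cell_def)
    qed
    then show "y \<in> iS_neighbors L \<phi> P E"
      using y by (auto simp: iS_neighbors_def cell_def)
  qed
  have sub2: "iS_neighbors L \<phi> P E \<subseteq> U 1"
  proof
    fix y assume "y \<in> iS_neighbors L \<phi> P E"
    then obtain l where y: "l \<in> {1..L}" "y \<in> P" "y \<in> sector L 0 \<phi> l"
      and less: "\<And>e. e \<in> E \<inter> sector L 0 \<phi> l \<Longrightarrow> norm y < norm e"
      by (auto simp: iS_neighbors_def)
    obtain e where e: "e \<in> E" "e \<in> cell L h \<phi> l (\<kappa> l)" using nonempty[OF y(1)] by blast
    obtain j where j: "y \<in> annulus (h * real j) (h * real (Suc j))"
      using annulus_index[OF \<open>0 < h\<close>] by blast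
    have "norm y < norm e" using less[of e] e by (simp add: cell_def)
    then have "\<not> \<kappa> l < j"
      using annulus_less[OF \<open>0 < h\<close> _ j, of e "\<kappa> l"] e by (auto simp: cell_def)
    then have "(l, j) \<in> (SIGMA l:{1..L}. {..<\<kappa> l + 1})" "y \<in> P \<inter> cell L h \<phi> l j"
      using y j by (auto simp: cell_def)
    then show "y \<in> U 1" unfolding U_def by blast
  qed
  show "finite (iS_neighbors L \<phi> P E)" using sub2 finU by (rule finite_subset)
  then show "(\<Sum>l\<in>{1..L}. \<Sum>j<\<kappa> l. card (P \<inter> cell L h \<phi> l j)) \<le> card (iS_neighbors L \<phi> P E)"
    using card_mono[OF _ sub1] cardU[of 0] by simp
  show "card (iS_neighbors L \<phi> P E) \<le> (\<Sum>l\<in>{1..L}. \<Sum>j<\<kappa> l + 1. card (P \<inter> cell L h \<phi> l j))"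
    using card_mono[OF finU sub2] cardU[of 1] by simp
qed

text \<open>For \<open>0 \<le> s \<le> 1\<close> more nodes mean a smaller power, so
  \<open>c = 1\<close> bounds from below. At \<open>s = 1\<close> the sandwich is the indicator of
  the event that every sector shows an eavesdropper within \<open>K\<close> cells; off that event
  all sandwich terms are 0 and only \<open>0 \<le> v \<le> 1\<close> remains, whence the correction
  term.\<close>

lemma sandwich_pgf_bounds:
  assumes "0 < h" "locally_finite P" "locally_finite E" and s: "0 \<le> s" "s \<le> 1"
    and N: "finite (iS_neighbors L \<phi> P E) \<Longrightarrow> v = s ^ card (iS_neighbors L \<phi> P E)"
    and v: "0 \<le> v" "v \<le> 1"
  defines "X \<equiv> (\<lambda>l j. card (P \<inter> cell L h \<phi> l j))" and "Y \<equiv> (\<lambda>l j. card (E \<inter> cell L h \<phi> l j))"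
  shows "sandwich L K 1 s X Y \<le> v"
    "v \<le> sandwich L K 0 s X Y + (1 - sandwich L K 0 1 X Y)"
proof -
  have "sandwich L K 1 s X Y \<le> v \<and> v \<le> sandwich L K 0 s X Y + (1 - sandwich L K 0 1 X Y)"
  proof (cases "\<exists>\<kappa>\<in>{1..L} \<rightarrow>\<^sub>E {..<K}. first_cell L Y \<kappa>")
    case True
    then obtain \<kappa> where \<kappa>: "\<kappa> \<in> {1..L} \<rightarrow>\<^sub>E {..<K}" "first_cell L Y \<kappa>" by blast
    note b = iS_neighbors_card_bounds[OF assms(1,2) \<kappa>(2)[unfolded Y_def] assms(3)]
    have "legit_weight L K 1 s X \<kappa> \<le> v" "v \<le> legit_weight L K 0 s X \<kappa>"
      unfolding legit_weight_eq[OF \<kappa>(1) order_refl] legit_weight_eq[OF \<kappa>(1) zero_le_one]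
        N[OF b(1)] X_def add_0_right
      by (rule power_decreasing[OF b(3) s], rule power_decreasing[OF b(2) s])
    moreover have "legit_weight L K 0 1 X \<kappa> = 1"
      by (simp add: legit_weight_def)
    ultimately show ?thesis
      by (simp add: sandwich_eq[OF \<kappa>(2,1)])
  next
    case False
    then show ?thesis using v by (simp add: sandwich_eq_0)
  qed
  then show "sandwich L K 1 s X Y \<le> v" "v \<le> sandwich L K 0 s X Y + (1 - sandwich L K 0 1 X Y)"
    by auto
qed

section \<open>Measurability of the out-degree\<close>

text \<open>In the closed ball around \<open>x\<close> through a given \<open>e\<close> only
  finitely many eavesdroppers compete, so a nearest one exists; it stays nearest overall because
  points outside the ball are farther away. If \<open>E \<inter> S\<close> is empty, both sides hold
  vacuously.\<close>

lemma arg_min_less_iff: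
  assumes "locally_finite E"
  shows "(\<forall>e. is_arg_min (dist x) (\<lambda>e. e \<in> E \<inter> S) e \<longrightarrow> d < dist x e) \<longleftrightarrow> (\<forall>e\<in>E \<inter> S. d < dist x e)"
proof
  assume *: "\<forall>e. is_arg_min (dist x) (\<lambda>e. e \<in> E \<inter> S) e \<longrightarrow> d < dist x e"
  show "\<forall>e\<in>E \<inter> S. d < dist x e"
  proof
    fix e assume e: "e \<in> E \<inter> S"
    define C where "C = E \<inter> S \<inter> cball x (dist x e)"
    have "finite C"
      using assms bounded_cball[of x "dist x e"] unfolding C_def locally_finite_def
      by (auto intro: finite_subset[of _ "E \<inter> cball x (dist x e)"])
    moreover have "e \<in> C" using e by (simp add: C_def)
    ultimately obtain m where m: "is_arg_min (dist x) (\<lambda>e. e \<in> C) m"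
      using ex_is_arg_min_if_finite[of C "dist x"] by auto
    then have "m \<in> C" and least: "\<And>y. y \<in> C \<Longrightarrow> dist x m \<le> dist x y"
      by (auto simp: is_arg_min_def not_less)
    have le: "dist x m \<le> dist x e" using least[OF \<open>e \<in> C\<close>] .
    have "dist x m \<le> dist x y" if "y \<in> E \<inter> S" for y
    proof (cases "y \<in> C")
      case False
      then show ?thesis using le that by (simp add: C_def)
    qed (rule least)
    then have "is_arg_min (dist x) (\<lambda>e. e \<in> E \<inter> S) m"
      using \<open>m \<in> C\<close> by (auto simp: is_arg_min_def C_def not_less)
    then have "d < dist x m" using * by blast
    then show "d < dist x e" using le by simp
  qed
qed (simp add: is_arg_min_def)

lemma iS_edge_iff:
  assumes "locally_finite E"
  shows "iS_edge L x \<phi> E i j \<longleftrightarrow>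
    (\<exists>l\<in>{1..L}. x j \<in> sector L (x i) (\<phi> i) l \<and>
      (\<forall>e\<in>E \<inter> sector L (x i) (\<phi> i) l. dist (x i) (x j) < dist (x i) e))"
  unfolding iS_edge_def arg_min_less_iff[OF assms] ..

definition typical_edge ::
    "nat \<Rightarrow> (nat \<Rightarrow> point) \<Rightarrow> (nat \<Rightarrow> real) \<Rightarrow> point set \<Rightarrow> nat \<Rightarrow> bool" where
  "typical_edge L x \<phi> E j \<longleftrightarrow> (\<exists>i. case_nat 0 x i = 0 \<and> iS_edge L (case_nat 0 x) \<phi> E i (Suc j))"

text \<open>The index \<open>i\<close> in \<^const>\<open>typical_edge\<close> is \<open>0\<close> unless a legitimate node happens to lie at the
  origin, in which case it shares the out-arcs of the typical node.\<close>

lemma not_in_own_sector: "x \<notin> sector L x \<phi> l"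
  by (auto simp: sector_def polar_angle_def)

text \<open>The origin is allowed among the nodes, since measurability of the out-degree concerns
  every outcome and not almost every one. Injectivity matters because arcs are pairs of points, not
  of indices.\<close>

lemma ext_out_degree_iS_graph:
  assumes "inj x"
  shows "ext_out_degree (with_proj (iS_graph L (case_nat 0 x) \<phi> E)) 0 =
    (if finite {j. typical_edge L x \<phi> E j} then enat (card {j. typical_edge L x \<phi> E j}) else \<infinity>)"
proof -
  let ?G = "with_proj (iS_graph L (case_nat 0 x) \<phi> E)"
  have "out_arcs ?G 0 = (\<lambda>j. (0 :: point, x j)) ` {j. typical_edge L x \<phi> E j}"
  proof (intro equalityI subsetI)
    fix a assume "a \<in> out_arcs ?G 0"
    then obtain i k where ik: "a = (case_nat 0 x i, case_nat 0 x k)" "case_nat 0 x i = 0"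
      "iS_edge L (case_nat 0 x) \<phi> E i k"
      by (auto simp: out_arcs_def iS_graph_def)
    \<comment> \<open>An arc with target index 0 would be a loop at the origin, and no point lies in
      its own sector.\<close>
    have "k \<noteq> 0"
    proof
      assume "k = 0"
      then show False
        using ik(2,3) not_in_own_sector[of "0 :: point" L "\<phi> i"] by (auto simp: iS_edge_def)
    qed
    then obtain j where "k = Suc j" by (cases k) auto
    then show "a \<in> (\<lambda>j. (0 :: point, x j)) ` {j. typical_edge L x \<phi> E j}"
      using ik by (auto simp: typical_edge_def)
  next
    fix a assume "a \<in> (\<lambda>j. (0 :: point, x j)) ` {j. typical_edge L x \<phi> E j}"
    then obtain i j where "a = (0 :: point, x j)" "case_nat 0 x i = 0" "iS_edge L (case_nat 0 x) \<phi> E i (Suc j)"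
      by (auto simp: typical_edge_def)
    then have "a = (case_nat 0 x i, case_nat 0 x (Suc j))" by simp
    then show "a \<in> out_arcs ?G 0"
      using \<open>case_nat 0 x i = 0\<close> \<open>iS_edge L (case_nat 0 x) \<phi> E i (Suc j)\<close>
      unfolding out_arcs_def iS_graph_def by (simp del: nat.case) blast
  qed
  moreover have "inj (\<lambda>j. (0 :: point, x j))" using assms by (simp add: inj_def)
  then have "inj_on (\<lambda>j. (0 :: point, x j)) {j. typical_edge L x \<phi> E j}"
    by (rule inj_on_subset) simp
  ultimately show ?thesis
    by (simp add: ext_out_degree_def out_degree_def card_image finite_image_iff)
qed

lemma typical_edge_iS_neighbors:
  assumes "locally_finite E" "0 \<notin> range x"
  shows "x ` {j. typical_edge L x \<phi> E j} = iS_neighbors L (\<phi> 0) (range x) E"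
proof -
  have "case_nat 0 x i = 0 \<longleftrightarrow> i = 0" for i
    using assms(2) by (cases i) (auto simp: image_def)
  then have "typical_edge L x \<phi> E j \<longleftrightarrow> (\<exists>l\<in>{1..L}. x j \<in> sector L 0 (\<phi> 0) l \<and>
      (\<forall>e\<in>E \<inter> sector L 0 (\<phi> 0) l. norm (x j) < norm e))" for j
    by (simp add: typical_edge_def iS_edge_iff[OF assms(1)])
  then show ?thesis by (auto simp: iS_neighbors_def)
qed

lemma sets_sector_graph:
  assumes "1 \<le> L"
  shows "{p :: (point \<times> real) \<times> point. snd p \<in> sector L (fst (fst p)) (snd (fst p)) l} \<in> sets borel"
  by (intro borel_open open_sector_graph assms)

lemma pred_iS_edge:
  fixes x :: "nat \<Rightarrow> 'w \<Rightarrow> point"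
  assumes L: "1 \<le> L"
    and lf: "\<And>\<omega>. \<omega> \<in> space M \<Longrightarrow> locally_finite (E \<omega>)"
    and meas: "\<And>B. B \<in> sets borel \<Longrightarrow> bounded B \<Longrightarrow> (\<lambda>\<omega>. card (E \<omega> \<inter> B)) \<in> M \<rightarrow>\<^sub>M count_space UNIV"
    and x: "\<And>i. x i \<in> borel_measurable M" and \<phi>: "\<And>i. \<phi> i \<in> borel_measurable M"
  shows "Measurable.pred M (\<lambda>\<omega>. iS_edge L (\<lambda>i. x i \<omega>) (\<lambda>i. \<phi> i \<omega>) (E \<omega>) i j)"
proof -
  note [measurable] = x \<phi>
  \<comment> \<open>The section of \<open>C l\<close> at apex, offset and node consists of the
    places where an eavesdropper blocks the edge through sector \<open>l\<close>.\<close>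
  define C where "C l = {p :: ((point \<times> real) \<times> point) \<times> point.
      snd p \<in> sector L (fst (fst (fst p))) (snd (fst (fst p))) l \<and>
      dist (fst (fst (fst p))) (snd p) \<le> dist (fst (fst (fst p))) (snd (fst p))}" for l
  define Y where "Y \<omega> = ((x i \<omega>, \<phi> i \<omega>), x j \<omega>)" for \<omega>
  have Y: "Y \<in> borel_measurable M" unfolding Y_def by measurable
  have C: "C l \<in> sets (borel \<Otimes>\<^sub>M borel)" for l
  proof -
    have "(\<lambda>p :: ((point \<times> real) \<times> point) \<times> point. (fst (fst p), snd p)) -`
        {p :: (point \<times> real) \<times> point. snd p \<in> sector L (fst (fst p)) (snd (fst p)) l} \<in> sets borel"
      by (intro borel_open open_vimage open_sector_graph L continuous_intros)
    moreover have "{p :: ((point \<times> real) \<times> point) \<times> point.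
        dist (fst (fst (fst p))) (snd p) \<le> dist (fst (fst (fst p))) (snd (fst p))} \<in> sets borel"
      by (intro borel_closed closed_Collect_le continuous_intros)
    ultimately have "C l \<in> sets borel"
      unfolding C_def Collect_conj_eq vimage_Collect_eq fst_conv snd_conv by (rule sets.Int)
    then show ?thesis by (simp only: borel_prod)
  qed
  have sec: "Measurable.pred M (\<lambda>\<omega>. x j \<omega> \<in> sector L (x i \<omega>) (\<phi> i \<omega>) l)" for l
  proof -
    have "{\<omega>\<in>space M. x j \<omega> \<in> sector L (x i \<omega>) (\<phi> i \<omega>) l} =
        Y -` {p. snd p \<in> sector L (fst (fst p)) (snd (fst p)) l} \<inter> space M"
      by (auto simp: Y_def)
    then show ?thesis
      unfolding pred_def using measurable_sets[OF Y sets_sector_graph[OF L]] by simp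
  qed
  have emp: "Measurable.pred M (\<lambda>\<omega>. E \<omega> \<inter> Pair (Y \<omega>) -` C l = {})" for l
    by (rule pred_count_section_empty[OF lf meas C Y])
  have "Measurable.pred M (\<lambda>\<omega>. \<exists>l\<in>{1..L}. x j \<omega> \<in> sector L (x i \<omega>) (\<phi> i \<omega>) l \<and>
      E \<omega> \<inter> Pair (Y \<omega>) -` C l = {})"
    by (rule pred_intros_finite(4)[OF finite_atLeastAtMost pred_intros_logic(3)[OF sec emp]])
  moreover have "(\<exists>l\<in>{1..L}. x j \<omega> \<in> sector L (x i \<omega>) (\<phi> i \<omega>) l \<and> E \<omega> \<inter> Pair (Y \<omega>) -` C l = {}) \<longleftrightarrow>
      iS_edge L (\<lambda>i. x i \<omega>) (\<lambda>i. \<phi> i \<omega>) (E \<omega>) i j" if "\<omega> \<in> space M" for \<omega>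
  proof -
    have "E \<omega> \<inter> Pair (Y \<omega>) -` C l = {} \<longleftrightarrow>
        (\<forall>e\<in>E \<omega> \<inter> sector L (x i \<omega>) (\<phi> i \<omega>) l. dist (x i \<omega>) (x j \<omega>) < dist (x i \<omega>) e)" for l
      unfolding C_def Y_def disjoint_iff vimage_Collect_eq mem_Collect_eq fst_conv snd_conv not_le[symmetric]
      by blast
    then show ?thesis unfolding iS_edge_iff[OF lf[OF that]] by simp
  qed
  ultimately show ?thesis by (subst measurable_cong[symmetric]) auto
qed

lemma measurable_N_out:
  fixes x :: "nat \<Rightarrow> 'w \<Rightarrow> point"
  assumes L: "1 \<le> L"
    and lf: "\<And>\<omega>. \<omega> \<in> space M \<Longrightarrow> locally_finite (E \<omega>)"
    and meas: "\<And>B. B \<in> sets borel \<Longrightarrow> bounded B \<Longrightarrow> (\<lambda>\<omega>. card (E \<omega> \<inter> B)) \<in> M \<rightarrow>\<^sub>M count_space UNIV"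
    and x: "\<And>i. x i \<in> borel_measurable M" and \<phi>: "\<And>i. \<phi> i \<in> borel_measurable M"
    and inj: "\<And>\<omega>. \<omega> \<in> space M \<Longrightarrow> inj (\<lambda>i. x i \<omega>)"
  shows "N_out L x \<phi> E \<in> M \<rightarrow>\<^sub>M count_space UNIV"
proof -
  \<comment> \<open>The typical node joins as a constant random point, so that one edge lemma covers
    every index.\<close>
  define x' where "x' = case_nat (\<lambda>_. 0) x"
  have x': "x' i \<in> borel_measurable M" for i
    using x by (cases i) (auto simp: x'_def)
  have x'_eq: "(\<lambda>i. x' i \<omega>) = case_nat 0 (\<lambda>i. x i \<omega>)" for \<omega>
    by (auto simp: x'_def split: nat.split)
  have "Measurable.pred M (\<lambda>\<omega>. \<exists>i. x' i \<omega> = 0 \<and> iS_edge L (\<lambda>i. x' i \<omega>) (\<lambda>i. \<phi> i \<omega>) (E \<omega>) i (Suc j))" for j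
  proof -
    have edge: "Measurable.pred M (\<lambda>\<omega>. iS_edge L (\<lambda>i. x' i \<omega>) (\<lambda>i. \<phi> i \<omega>) (E \<omega>) i (Suc j))" for i
      by (rule pred_iS_edge[OF L lf meas x' \<phi>])
    have "{\<omega>\<in>space M. x' i \<omega> = 0} = x' i -` {0} \<inter> space M" for i by auto
    then have "Measurable.pred M (\<lambda>\<omega>. x' i \<omega> = 0)" for i
      unfolding pred_def using measurable_sets[OF x', of "{0}" i] by simp
    note [measurable] = this edge
    show ?thesis by measurable
  qed
  then have "Measurable.pred M (\<lambda>\<omega>. typical_edge L (\<lambda>i. x i \<omega>) (\<lambda>i. \<phi> i \<omega>) (E \<omega>) j)" for j
    by (simp only: typical_edge_def x'_eq fun_cong[OF x'_eq])
  from measurable_enat_card[OF this] show ?thesis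
    by (rule measurable_cong[THEN iffD1, rotated]) (simp add: N_out_def ext_out_degree_iS_graph[OF inj])
qed

lemma measurable_sandwich:
  assumes X: "\<And>l j. l \<in> {1..L} \<Longrightarrow> X l j \<in> G \<rightarrow>\<^sub>M count_space UNIV"
    and Y: "\<And>l j. l \<in> {1..L} \<Longrightarrow> Y l j \<in> G \<rightarrow>\<^sub>M count_space UNIV"
  shows "(\<lambda>x. legit_weight L K c s (\<lambda>l j. X l j x) \<kappa>) \<in> borel_measurable G"
    and "(\<lambda>x. eaves_weight L K (\<lambda>l j. Y l j x) \<kappa>) \<in> borel_measurable G"
    and "(\<lambda>x. sandwich L K c s (\<lambda>l j. X l j x) (\<lambda>l j. Y l j x)) \<in> borel_measurable G"
proof -
  show leg: "(\<lambda>x. legit_weight L K c s (\<lambda>l j. X l j x) \<kappa>) \<in> borel_measurable G" for \<kappa>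
    unfolding legit_weight_def split_beta
    by (intro borel_measurable_prod measurable_compose[OF X, of _ "\<lambda>n. _ ^ n"]) auto
  show eav: "(\<lambda>x. eaves_weight L K (\<lambda>l j. Y l j x) \<kappa>) \<in> borel_measurable G" for \<kappa>
    unfolding eaves_weight_def split_beta
    by (intro borel_measurable_prod measurable_compose[OF Y, of _ "\<lambda>n. if _ then of_bool (n = 0)
        else if _ then 1 - of_bool (n = 0) else 1"]) auto
  show "(\<lambda>x. sandwich L K c s (\<lambda>l j. X l j x) (\<lambda>l j. Y l j x)) \<in> borel_measurable G"
    unfolding sandwich_def using leg eav by (intro borel_measurable_sum borel_measurable_times)
qed

text \<open>Fubini's theorem over the offset requires measurability jointly in offset and outcome;
  the sections of \<open>C\<close> are the sectors for the various offsets.\<close>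

lemma measurable_count_cell:
  assumes "1 \<le> L"
    and lf: "\<And>\<omega>. \<omega> \<in> space F \<Longrightarrow> locally_finite (P \<omega>)"
    and meas: "\<And>B. B \<in> sets borel \<Longrightarrow> bounded B \<Longrightarrow> (\<lambda>\<omega>. card (P \<omega> \<inter> B)) \<in> F \<rightarrow>\<^sub>M count_space UNIV"
  shows "(\<lambda>p. card (P (snd p) \<inter> cell L h (fst p) l j)) \<in> borel \<Otimes>\<^sub>M F \<rightarrow>\<^sub>M count_space UNIV"
proof -
  define C where "C = {q :: real \<times> point. snd q \<in> sector L 0 (fst q) l}"
  have "C = (\<lambda>q. ((0, fst q), snd q)) -`
      {p :: (point \<times> real) \<times> point. snd p \<in> sector L (fst (fst p)) (snd (fst p)) l}"
    by (auto simp: C_def)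
  also have "\<dots> \<in> sets borel"
    by (intro borel_open open_vimage open_sector_graph assms continuous_intros)
  finally have C: "C \<in> sets (borel \<Otimes>\<^sub>M borel)" by (simp only: borel_prod)
  have "Pair \<phi> -` C = sector L 0 \<phi> l" for \<phi> by (auto simp: C_def)
  then show ?thesis
    using measurable_count_section_bounded[OF lf meas C annulus_borel bounded_annulus]
    by (simp add: cell_def split_beta)
qed

lemma point_process_sigma_Pow: "point_process_sigma M P \<subseteq> Pow (space M)"
proof
  fix A assume "A \<in> point_process_sigma M P"
  then have "A \<subseteq> space M"
    unfolding point_process_sigma_def by (rule sigma_sets_into_sp[rotated]) auto
  then show "A \<in> Pow (space M)" by simp
qed

text \<open>Independence is phrased through generated sigma-algebras, for which measurability in
  \<open>M\<close> would be too weak; \<open>G\<close> will be the events of one process or the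
  union of those of both.\<close>

lemma measurable_count_sigma:
  assumes "point_process_sigma M P \<subseteq> G" "G \<subseteq> Pow (space M)" "B \<in> sets borel" "bounded B"
  shows "(\<lambda>\<omega>. card (P \<omega> \<inter> B)) \<in> sigma (space M) G \<rightarrow>\<^sub>M count_space UNIV"
proof (subst measurable_count_space_eq2_countable, intro conjI ballI)
  fix k
  have "{\<omega>\<in>space M. card (P \<omega> \<inter> B) = k} \<in> point_process_sigma M P"
    unfolding point_process_sigma_def using assms(3,4) by (intro sigma_sets.Basic) blast
  then have "{\<omega>\<in>space M. card (P \<omega> \<inter> B) = k} \<in> sets (sigma (space M) G)"
    using assms(1,2) by auto
  moreover have "(\<lambda>\<omega>. card (P \<omega> \<inter> B)) -` {k} \<inter> space (sigma (space M) G) =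
      {\<omega>\<in>space M. card (P \<omega> \<inter> B) = k}"
    by (auto simp: space_measure_of_conv)
  ultimately show "(\<lambda>\<omega>. card (P \<omega> \<inter> B)) -` {k} \<inter> space (sigma (space M) G) \<in> sets (sigma (space M) G)"
    by simp
qed auto

section \<open>Generating functions\<close>

lemma (in prob_space) poisson_point_process_prod_integral:
  fixes f :: "'i \<Rightarrow> nat \<Rightarrow> real"
  assumes ppp: "poisson_point_process M lam P" and I: "finite I"
    and B: "\<And>i. i \<in> I \<Longrightarrow> B i \<in> sets borel" "\<And>i. i \<in> I \<Longrightarrow> bounded (B i)"
    and disj: "disjoint_family_on B I"
    and f: "\<And>i k. \<bar>f i k\<bar> \<le> 1"
  shows "(\<integral>\<omega>. (\<Prod>i\<in>I. f i (card (P \<omega> \<inter> B i))) \<partial>M) = (\<Prod>i\<in>I. \<integral>\<omega>. f i (card (P \<omega> \<inter> B i)) \<partial>M)"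
proof (rule indep_vars_lebesgue_integral[OF I])
  show ind: "indep_vars (\<lambda>_. borel) (\<lambda>i \<omega>. f i (card (P \<omega> \<inter> B i))) I"
    by (rule indep_vars_compose2[OF poisson_point_process_indep[OF ppp I B disj]]) auto
  show "integrable M (\<lambda>\<omega>. f i (card (P \<omega> \<inter> B i)))" if "i \<in> I" for i
    using f that ind by (intro integrable_const_bound[where B = 1]) (auto simp: indep_vars_def)
qed

text \<open>Groups the three independent families: it separates the two processes from each other,
  and the offsets from both processes jointly.\<close>

lemma (in prob_space) indep_set_collect:
  assumes "indep_sets E S" "\<And>i. i \<in> S \<Longrightarrow> Int_stable (E i)"
    and "I \<subseteq> S" "J \<subseteq> S" "I \<inter> J = {}"
  shows "indep_set (sigma_sets (space M) (\<Union>i\<in>I. E i)) (sigma_sets (space M) (\<Union>i\<in>J. E i))"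
proof -
  have "indep_sets (\<lambda>b. sigma_sets (space M) (\<Union>i\<in>case_bool I J b. E i)) UNIV"
  proof (rule indep_sets_collect_sigma)
    show "indep_sets E (\<Union>b\<in>UNIV. case_bool I J b)"
      using assms by (intro indep_sets_mono_index[OF _ assms(1)]) (auto split: bool.splits)
    show "Int_stable (E i)" if "i \<in> case_bool I J b" for b i
      using that assms by (auto split: bool.splits)
    show "disjoint_family_on (case_bool I J) UNIV"
      using assms(5) by (auto simp: disjoint_family_on_def split: bool.splits)
  qed
  then show ?thesis
    unfolding indep_set_def by (rule indep_sets_mono_sets) (auto split: bool.splits)
qed

lemma prod_legit_factors:
  assumes "\<kappa> \<in> {1..L} \<rightarrow>\<^sub>E {..<K}" "c \<le> 1"
  shows "(\<Prod>(l, j)\<in>{1..L} \<times> {..<K}. if j < \<kappa> l + c then g else 1) = (\<Prod>l\<in>{1..L}. g ^ (\<kappa> l + c) :: real)"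
proof -
  have "(\<Prod>j<K. if j < \<kappa> l + c then g else 1) = g ^ (\<kappa> l + c)" if "l \<in> {1..L}" for l
  proof -
    have "\<kappa> l < K" using PiE_mem[OF assms(1) that] by simp
    then have "\<kappa> l + c \<le> K" using assms(2) by simp
    then have "{..<K} \<inter> {j. j < \<kappa> l + c} = {..<\<kappa> l + c}" by auto
    then show ?thesis by (simp add: prod.If_cases)
  qed
  then show ?thesis by (simp flip: prod.cartesian_product)
qed

lemma prod_eaves_factors:
  assumes "\<kappa> \<in> {1..L} \<rightarrow>\<^sub>E {..<K}"
  shows "(\<Prod>(l, j)\<in>{1..L} \<times> {..<K}. if j < \<kappa> l then q else if j = \<kappa> l then 1 - q else 1) =
    (\<Prod>l\<in>{1..L}. q ^ \<kappa> l * (1 - q) :: real)"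
proof -
  have "(\<Prod>j<K. if j < \<kappa> l then q else if j = \<kappa> l then 1 - q else 1) = q ^ \<kappa> l * (1 - q)"
    if "l \<in> {1..L}" for l
  proof -
    have "\<kappa> l < K" using PiE_mem[OF assms that] by simp
    then have "(\<Prod>j<K. if j < \<kappa> l then q else if j = \<kappa> l then 1 - q else 1) =
        (\<Prod>j<Suc (\<kappa> l). if j < \<kappa> l then q else if j = \<kappa> l then 1 - q else 1)"
      by (intro prod.mono_neutral_right) auto
    also have "\<dots> = q ^ \<kappa> l * (1 - q)" by simp
    finally show ?thesis .
  qed
  then show ?thesis by (simp flip: prod.cartesian_product)
qed

text \<open>\<open>q\<close> is the probability that a cell has no eavesdropper and \<open>g\<close>
  the generating function at \<open>s\<close> of the number of nodes in a cell. A sector with first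
  occupied cell \<open>k\<close> contributes \<open>g ^ (k + c) * q ^ k * (1 - q)\<close>, and
  different sectors are independent.\<close>

lemma (in prob_space) sandwich_expectation:
  assumes L: "1 \<le> L" and h: "0 < h" and s: "0 \<le> s" "s \<le> 1" and c: "c \<le> 1"
    and Pl: "poisson_point_process M lam_l P_l" and Pe: "poisson_point_process M lam_e P_e"
    and ind: "indep_set (sigma_sets (space M) (point_process_sigma M P_l))
      (sigma_sets (space M) (point_process_sigma M P_e))"
  defines "a \<equiv> pi * h / real L"
  defines "q \<equiv> exp (- (lam_e * a))" and "g \<equiv> exp (- (lam_l * a * (1 - s)))"
  shows "(\<integral>\<omega>. sandwich L K c s (\<lambda>l j. card (P_l \<omega> \<inter> cell L h \<phi> l j))
      (\<lambda>l j. card (P_e \<omega> \<inter> cell L h \<phi> l j)) \<partial>M) = (g ^ c * (\<Sum>k<K. (q * g) ^ k * (1 - q))) ^ L"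
proof -
  let ?X = "\<lambda>\<omega> l j. card (P_l \<omega> \<inter> cell L h \<phi> l j)" and ?Y = "\<lambda>\<omega> l j. card (P_e \<omega> \<inter> cell L h \<phi> l j)"
  let ?I = "{1..L} \<times> {..<K}"
  have cb: "cell L h \<phi> l j \<in> sets borel" for l j by (rule cell_borel[OF L])
  have fin: "finite ?I" by simp
  have disj: "disjoint_family_on (\<lambda>(l, j). cell L h \<phi> l j) ?I"
    by (rule disjoint_family_on_mono[OF _ disjoint_cells[OF h]]) auto
  have area: "measure lborel (cell L h \<phi> l j) = a" if "l \<in> {1..L}" for l j
    using measure_cell[OF L h that] by (simp add: a_def)
  have E_legit: "(\<integral>\<omega>. legit_weight L K c s (?X \<omega>) \<kappa> \<partial>M) = (\<Prod>l\<in>{1..L}. g ^ (\<kappa> l + c))"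
    if \<kappa>: "\<kappa> \<in> {1..L} \<rightarrow>\<^sub>E {..<K}" for \<kappa>
  proof -
    let ?f = "\<lambda>p k. (if snd p < \<kappa> (fst p) + c then s else 1) ^ k"
    have f: "\<bar>?f p k\<bar> \<le> 1" for p k using s by (auto simp: power_abs intro: power_le_one)
    have "(\<integral>\<omega>. legit_weight L K c s (?X \<omega>) \<kappa> \<partial>M) =
        (\<integral>\<omega>. (\<Prod>p\<in>?I. ?f p (card (P_l \<omega> \<inter> (case p of (l, j) \<Rightarrow> cell L h \<phi> l j)))) \<partial>M)"
      by (simp add: legit_weight_def split_beta)
    also have "\<dots> = (\<Prod>p\<in>?I. \<integral>\<omega>. ?f p (card (P_l \<omega> \<inter> (case p of (l, j) \<Rightarrow> cell L h \<phi> l j))) \<partial>M)"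
      using cb bounded_cell by (intro poisson_point_process_prod_integral[OF Pl fin _ _ disj f]) auto
    also have "\<dots> = (\<Prod>(l, j)\<in>?I. if j < \<kappa> l + c then g else 1)"
    proof (rule prod.cong[OF refl])
      fix p assume "p \<in> ?I"
      then obtain l j where p: "p = (l, j)" "l \<in> {1..L}" by auto
      have "(\<integral>\<omega>. s ^ ?X \<omega> l j \<partial>M) = g"
        using poisson_pgf[OF poisson_point_process_measurable[OF Pl cb bounded_cell]
            poisson_point_process_prob[OF Pl cb bounded_cell] s, of l j] area[OF p(2), of j]
        by (simp add: g_def)
      then show "(\<integral>\<omega>. ?f p (card (P_l \<omega> \<inter> (case p of (l, j) \<Rightarrow> cell L h \<phi> l j))) \<partial>M) =
          (case p of (l, j) \<Rightarrow> if j < \<kappa> l + c then g else 1)"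
        by (simp add: p(1) prob_space)
    qed
    also have "\<dots> = (\<Prod>l\<in>{1..L}. g ^ (\<kappa> l + c))" by (rule prod_legit_factors[OF \<kappa> c])
    finally show ?thesis .
  qed
  have E_eaves: "(\<integral>\<omega>. eaves_weight L K (?Y \<omega>) \<kappa> \<partial>M) = (\<Prod>l\<in>{1..L}. q ^ \<kappa> l * (1 - q))"
    if \<kappa>: "\<kappa> \<in> {1..L} \<rightarrow>\<^sub>E {..<K}" for \<kappa>
  proof -
    let ?f = "\<lambda>p k. if snd p < \<kappa> (fst p) then of_bool (k = 0) else
        if snd p = \<kappa> (fst p) then 1 - of_bool (k = 0) else 1 :: real"
    have f: "\<bar>?f p k\<bar> \<le> 1" for p and k :: nat by simp
    have "(\<integral>\<omega>. eaves_weight L K (?Y \<omega>) \<kappa> \<partial>M) =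
        (\<integral>\<omega>. (\<Prod>p\<in>?I. ?f p (card (P_e \<omega> \<inter> (case p of (l, j) \<Rightarrow> cell L h \<phi> l j)))) \<partial>M)"
      unfolding eaves_weight_def
      by (intro Bochner_Integration.integral_cong prod.cong refl) (simp only: split_beta)
    also have "\<dots> = (\<Prod>p\<in>?I. \<integral>\<omega>. ?f p (card (P_e \<omega> \<inter> (case p of (l, j) \<Rightarrow> cell L h \<phi> l j))) \<partial>M)"
      using cb bounded_cell by (intro poisson_point_process_prod_integral[OF Pe fin _ _ disj f]) auto
    also have "\<dots> = (\<Prod>(l, j)\<in>?I. if j < \<kappa> l then q else if j = \<kappa> l then 1 - q else 1)"
    proof (rule prod.cong[OF refl])
      fix p assume "p \<in> ?I"
      then obtain l j where p: "p = (l, j)" "l \<in> {1..L}" by auto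
      let ?A = "{\<omega>\<in>space M. ?Y \<omega> l j = 0}"
      have ev: "?A \<in> events"
        using measurable_sets[OF poisson_point_process_measurable[OF Pe cb bounded_cell], of "{0}" l j]
        by (simp add: vimage_def Int_def conj_commute)
      have "prob ?A = q"
        using poisson_point_process_prob[OF Pe cb bounded_cell, of l j 0] area[OF p(2), of j]
        by (simp add: q_def)
      moreover have "(\<integral>\<omega>. of_bool (?Y \<omega> l j = 0) \<partial>M) = (\<integral>\<omega>. indicator ?A \<omega> \<partial>M :: real)"
        by (intro Bochner_Integration.integral_cong) (auto simp: indicator_def)
      ultimately have E0: "(\<integral>\<omega>. of_bool (?Y \<omega> l j = 0) \<partial>M) = q"
        using ev by simp
      have "(\<integral>\<omega>. 1 - of_bool (?Y \<omega> l j = 0) \<partial>M) = (\<integral>\<omega>. 1 - indicator ?A \<omega> \<partial>M :: real)"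
        by (intro Bochner_Integration.integral_cong) (auto simp: indicator_def)
      also have "\<dots> = 1 - q"
        using ev \<open>prob ?A = q\<close>
        by (subst Bochner_Integration.integral_diff) (auto simp: prob_space less_top[symmetric])
      finally have E1: "(\<integral>\<omega>. 1 - of_bool (?Y \<omega> l j = 0) \<partial>M) = 1 - q" .
      show "(\<integral>\<omega>. ?f p (card (P_e \<omega> \<inter> (case p of (l, j) \<Rightarrow> cell L h \<phi> l j))) \<partial>M) =
          (case p of (l, j) \<Rightarrow> if j < \<kappa> l then q else if j = \<kappa> l then 1 - q else 1)"
        unfolding p(1) fst_conv snd_conv prod.case
        using E0 E1 by (cases "j < \<kappa> l"; cases "j = \<kappa> l") (simp_all add: prob_space)
    qed
    also have "\<dots> = (\<Prod>l\<in>{1..L}. q ^ \<kappa> l * (1 - q))" by (rule prod_eaves_factors[OF \<kappa>])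
    finally show ?thesis .
  qed
  \<comment> \<open>Measurability for the generated sigma-algebras serves the independence of the
    two weights, that in \<open>M\<close> the integrability of their product.\<close>
  have mX: "(\<lambda>\<omega>. ?X \<omega> l j) \<in> sigma (space M) (point_process_sigma M P_l) \<rightarrow>\<^sub>M count_space UNIV"
    and mY: "(\<lambda>\<omega>. ?Y \<omega> l j) \<in> sigma (space M) (point_process_sigma M P_e) \<rightarrow>\<^sub>M count_space UNIV" for l j
    by (rule measurable_count_sigma[OF order_refl point_process_sigma_Pow cb bounded_cell])+
  have mX': "(\<lambda>\<omega>. ?X \<omega> l j) \<in> M \<rightarrow>\<^sub>M count_space UNIV" and mY': "(\<lambda>\<omega>. ?Y \<omega> l j) \<in> M \<rightarrow>\<^sub>M count_space UNIV" for l j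
    by (rule poisson_point_process_measurable[OF Pl cb bounded_cell],
        rule poisson_point_process_measurable[OF Pe cb bounded_cell])
  have E_prod: "(\<integral>\<omega>. legit_weight L K c s (?X \<omega>) \<kappa> * eaves_weight L K (?Y \<omega>) \<kappa> \<partial>M) =
      (\<Prod>l\<in>{1..L}. g ^ c * ((q * g) ^ \<kappa> l * (1 - q)))"
    if \<kappa>: "\<kappa> \<in> {1..L} \<rightarrow>\<^sub>E {..<K}" for \<kappa>
  proof -
    have "(\<integral>\<omega>. legit_weight L K c s (?X \<omega>) \<kappa> * eaves_weight L K (?Y \<omega>) \<kappa> \<partial>M) =
        (\<integral>\<omega>. legit_weight L K c s (?X \<omega>) \<kappa> \<partial>M) * (\<integral>\<omega>. eaves_weight L K (?Y \<omega>) \<kappa> \<partial>M)"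
    proof (rule indep_set_integral_mult[OF ind, where c = 1])
      show "(\<lambda>\<omega>. legit_weight L K c s (?X \<omega>) \<kappa>) \<in> borel_measurable (sigma (space M) (point_process_sigma M P_l))"
        by (rule measurable_sandwich(1)[OF mX mX])
      show "(\<lambda>\<omega>. eaves_weight L K (?Y \<omega>) \<kappa>) \<in> borel_measurable (sigma (space M) (point_process_sigma M P_e))"
        by (rule measurable_sandwich(2)[OF mY mY])
      show "\<bar>legit_weight L K c s (?X \<omega>) \<kappa>\<bar> \<le> 1" "\<bar>eaves_weight L K (?Y \<omega>) \<kappa>\<bar> \<le> 1" for \<omega>
        using legit_weight_bounds[OF s] by (simp_all add: eaves_weight_eq[OF \<kappa>])
    qed
    then show ?thesis
      by (simp add: E_legit[OF \<kappa>] E_eaves[OF \<kappa>] power_add power_mult_distrib mult_ac flip: prod.distrib)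
  qed
  have "(\<integral>\<omega>. sandwich L K c s (?X \<omega>) (?Y \<omega>) \<partial>M) =
      (\<Sum>\<kappa>\<in>{1..L} \<rightarrow>\<^sub>E {..<K}. \<integral>\<omega>. legit_weight L K c s (?X \<omega>) \<kappa> * eaves_weight L K (?Y \<omega>) \<kappa> \<partial>M)"
    unfolding sandwich_def
  proof (rule Bochner_Integration.integral_sum)
    fix \<kappa> assume \<kappa>: "\<kappa> \<in> {1..L} \<rightarrow>\<^sub>E {..<K}"
    show "integrable M (\<lambda>\<omega>. legit_weight L K c s (?X \<omega>) \<kappa> * eaves_weight L K (?Y \<omega>) \<kappa>)"
    proof (rule integrable_const_bound[where B = 1])
      show "AE \<omega> in M. norm (legit_weight L K c s (?X \<omega>) \<kappa> * eaves_weight L K (?Y \<omega>) \<kappa>) \<le> 1"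
        using legit_weight_bounds[OF s] by (intro AE_I2) (simp add: eaves_weight_eq[OF \<kappa>])
      show "(\<lambda>\<omega>. legit_weight L K c s (?X \<omega>) \<kappa> * eaves_weight L K (?Y \<omega>) \<kappa>) \<in> borel_measurable M"
        by (intro borel_measurable_times measurable_sandwich(1)[OF mX' mX'] measurable_sandwich(2)[OF mY' mY'])
    qed
  qed
  also have "\<dots> = (\<Sum>\<kappa>\<in>{1..L} \<rightarrow>\<^sub>E {..<K}. \<Prod>l\<in>{1..L}. g ^ c * ((q * g) ^ \<kappa> l * (1 - q)))"
    by (rule sum.cong[OF refl E_prod])
  \<comment> \<open>Distributivity: summing products over all choice functions gives the product of
    the sums.\<close>
  also have "\<dots> = (\<Prod>l\<in>{1..L}. \<Sum>k<K. g ^ c * ((q * g) ^ k * (1 - q)))"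
    by (rule prod_sum_PiE[symmetric]) auto
  also have "\<dots> = (g ^ c * (\<Sum>k<K. (q * g) ^ k * (1 - q))) ^ L"
    by (simp add: sum_distrib_left)
  finally show ?thesis .
qed

section \<open>The generating function of the out-degree\<close>

text \<open>The value at infinity is the limit of \<open>s ^ n\<close> for
  \<open>0 \<le> s < 1\<close>, so an infinite out-degree contributes nothing to the generating
  function.\<close>

definition enat_power :: "real \<Rightarrow> enat \<Rightarrow> real" where
  "enat_power s N = (case N of enat n \<Rightarrow> s ^ n | \<infinity> \<Rightarrow> 0)"

lemma enat_power_simps [simp]: "enat_power s (enat n) = s ^ n" "enat_power s \<infinity> = 0"
  by (simp_all add: enat_power_def)

lemma enat_power_bounds: "0 \<le> s \<Longrightarrow> s \<le> 1 \<Longrightarrow> 0 \<le> enat_power s N \<and> enat_power s N \<le> 1"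
  by (cases N) (auto intro: power_le_one)

text \<open>The singleton has area 0, and the Poisson weight at 0 with mean 0 is
  \<open>0 ^ 0 = 1\<close>.\<close>

lemma (in prob_space) AE_origin_notin_poisson:
  assumes ppp: "poisson_point_process M lam P"
  shows "AE \<omega> in M. 0 \<notin> P \<omega>"
proof -
  have "prob {\<omega>\<in>space M. card (P \<omega> \<inter> {0}) = 0} = 1"
    using poisson_point_process_prob[OF ppp, of "{0}" 0] by simp
  moreover have "{\<omega>\<in>space M. card (P \<omega> \<inter> {0}) = 0} \<in> events"
    using measurable_sets[OF poisson_point_process_measurable[OF ppp, of "{0}"], of "{0}"]
    by (simp add: vimage_def Int_def conj_commute)
  ultimately have "AE \<omega> in M. card (P \<omega> \<inter> {0}) = 0"
    by (simp only: prob_Collect_eq_1)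
  then show ?thesis by eventually_elim auto
qed

lemma (in prob_space) N_out_pgf:
  fixes x :: "nat \<Rightarrow> 'a \<Rightarrow> point"
  assumes lam: "0 < lam_l" "0 < lam_e" and L: "1 \<le> L"
    and Pl: "poisson_point_process M lam_l P_l" and Pe: "poisson_point_process M lam_e P_e"
    and x: "\<And>i. x i \<in> borel_measurable M"
    and range: "\<And>\<omega>. \<omega> \<in> space M \<Longrightarrow> inj (\<lambda>i. x i \<omega>) \<and> P_l \<omega> = range (\<lambda>i. x i \<omega>)"
    and \<phi>: "\<And>i. \<phi> i \<in> borel_measurable M"
    and indep: "indep_sets (nth [point_process_sigma M P_l, point_process_sigma M P_e, offset_sigma M \<phi>]) {..<3}"
    and s: "0 \<le> s" "s < 1"
  shows "(\<integral>\<omega>. enat_power s (N_out L x \<phi> P_e \<omega>) \<partial>M) = (lam_e / (lam_e + lam_l * (1 - s))) ^ L"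
proof -
  note lfl = poisson_point_process_locally_finite[OF Pl]
  note lfe = poisson_point_process_locally_finite[OF Pe]
  let ?E = "nth [point_process_sigma M P_l, point_process_sigma M P_e, offset_sigma M \<phi>]"
  have N_meas: "N_out L x \<phi> P_e \<in> M \<rightarrow>\<^sub>M count_space UNIV"
    using range by (intro measurable_N_out[OF L lfe poisson_point_process_measurable[OF Pe] x \<phi>]) auto
  have stable: "Int_stable (?E i)" if "i \<in> {..<3}" for i
  proof -
    have sig: "Int_stable (sigma_sets (space M) A)" if "A \<subseteq> Pow (space M)" for A
    proof -
      interpret S: sigma_algebra "space M" "sigma_sets (space M) A"
        by (rule sigma_algebra_sigma_sets[OF that])
      show ?thesis by (auto simp: Int_stable_def)
    qed
    have "Int_stable (point_process_sigma M P)" for P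
      unfolding point_process_sigma_def by (rule sig) auto
    moreover have "Int_stable (offset_sigma M \<phi>)"
      unfolding offset_sigma_def by (rule sig) auto
    moreover have "i = 0 \<or> i = 1 \<or> i = 2" using that by auto
    ultimately show ?thesis by auto
  qed
  have ind_le: "indep_set (sigma_sets (space M) (point_process_sigma M P_l))
      (sigma_sets (space M) (point_process_sigma M P_e))"
    using indep_set_collect[OF indep stable, of "{0}" "{1}"] by simp
  \<comment> \<open>The offset must be independent of both processes jointly, since the sandwich
    depends on both.\<close>
  define B where "B = point_process_sigma M P_l \<union> point_process_sigma M P_e"
  have B_Pow: "B \<subseteq> Pow (space M)" using point_process_sigma_Pow by (auto simp: B_def)
  have "indep_set (sigma_sets (space M) (offset_sigma M \<phi>)) (sigma_sets (space M) B)"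
    using indep_set_collect[OF indep stable, of "{2}" "{0, 1}"] by (simp add: B_def)
  \<comment> \<open>Only the offset of the typical node enters, which is why the joint law of the
    offsets can be arbitrary.\<close>
  moreover have "sigma_sets (space M) {\<phi> 0 -` X \<inter> space M | X. X \<in> sets borel} \<subseteq>
      sigma_sets (space M) (offset_sigma M \<phi>)"
    unfolding offset_sigma_def by (intro sigma_sets_mono' subsetI sigma_sets.Basic) blast
  ultimately have ind_\<phi>: "indep_set (sigma_sets (space M) {\<phi> 0 -` X \<inter> space M | X. X \<in> sets borel})
      (sigma_sets (space M) B)"
    unfolding indep_sets2_eq by blast
  define X where "X P h p = (\<lambda>l j. card (P (snd p) \<inter> cell L h (fst p) l j))"
    for P :: "'a \<Rightarrow> point set" and h p
  \<comment> \<open>Offset and outcome are separate arguments, so that the offset can be frozen;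
    inserting \<open>(\<phi> 0 \<omega>, \<omega>)\<close> restores the actual quantity.\<close>
  define Z where "Z c t h K p = sandwich L K c t (X P_l h p) (X P_e h p)" for c t h K p
  have Z: "integrable M (\<lambda>\<omega>. Z c t h K (\<phi> 0 \<omega>, \<omega>))"
      "(\<integral>\<omega>. Z c t h K (\<phi> 0 \<omega>, \<omega>) \<partial>M) = (exp (- (lam_l * (pi * h / real L) * (1 - t))) ^ c *
        (\<Sum>k<K. (exp (- (lam_e * (pi * h / real L))) * exp (- (lam_l * (pi * h / real L) * (1 - t)))) ^ k *
          (1 - exp (- (lam_e * (pi * h / real L)))))) ^ L"
    if "c \<le> 1" "0 \<le> t" "t \<le> 1" "0 < h" for c t h K
  proof -
    have X_meas: "(\<lambda>p. X P h p l j) \<in> borel \<Otimes>\<^sub>M sigma (space M) B \<rightarrow>\<^sub>M count_space UNIV"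
      if "point_process_sigma M P \<subseteq> B" "\<And>\<omega>. \<omega> \<in> space M \<Longrightarrow> locally_finite (P \<omega>)" for P l j
      unfolding X_def
      by (rule measurable_count_cell[OF L _ measurable_count_sigma[OF that(1) B_Pow]])
        (use that(2) in \<open>simp add: space_measure_of_conv\<close>)
    have Z_meas: "Z c t h K \<in> borel_measurable (borel \<Otimes>\<^sub>M sigma (space M) B)"
      unfolding Z_def
      by (rule measurable_sandwich(3)[OF X_meas[OF _ lfl] X_meas[OF _ lfe]]) (auto simp: B_def)
    have bnd: "\<bar>Z c t h K p\<bar> \<le> 1" for p
      using sandwich_bounds[OF that(2,3)] by (simp add: Z_def)
    have const: "(\<integral>\<omega>. Z c t h K (y, \<omega>) \<partial>M) = (exp (- (lam_l * (pi * h / real L) * (1 - t))) ^ c *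
        (\<Sum>k<K. (exp (- (lam_e * (pi * h / real L))) * exp (- (lam_l * (pi * h / real L) * (1 - t)))) ^ k *
          (1 - exp (- (lam_e * (pi * h / real L)))))) ^ L" for y
      using sandwich_expectation[OF L that(4,2,3,1) Pl Pe ind_le] by (simp add: Z_def X_def)
    from indep_integral_const[OF ind_\<phi> \<phi> Z_meas bnd const]
    show "integrable M (\<lambda>\<omega>. Z c t h K (\<phi> 0 \<omega>, \<omega>))"
      "(\<integral>\<omega>. Z c t h K (\<phi> 0 \<omega>, \<omega>) \<partial>M) = (exp (- (lam_l * (pi * h / real L) * (1 - t))) ^ c *
        (\<Sum>k<K. (exp (- (lam_e * (pi * h / real L))) * exp (- (lam_l * (pi * h / real L) * (1 - t)))) ^ k *
          (1 - exp (- (lam_e * (pi * h / real L)))))) ^ L"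
      by blast+
  qed
  let ?v = "\<lambda>\<omega>. enat_power s (N_out L x \<phi> P_e \<omega>)"
  have v_int: "integrable M ?v"
    using enat_power_bounds[of s] s measurable_compose[OF N_meas, of "enat_power s" borel]
    by (intro integrable_const_bound[where B = 1]) auto
  \<comment> \<open>Outcomes with a legitimate node at the origin are discarded: such a node would
    add out-arcs of its own, with another offset.\<close>
  have AE_bounds: "AE \<omega> in M. Z 1 s h K (\<phi> 0 \<omega>, \<omega>) \<le> ?v \<omega> \<and>
      ?v \<omega> \<le> Z 0 s h K (\<phi> 0 \<omega>, \<omega>) + (1 - Z 0 1 h K (\<phi> 0 \<omega>, \<omega>))" if "0 < h" for h K
    using AE_origin_notin_poisson[OF Pl] AE_space
  proof eventually_elim
    case (elim \<omega>)
    then have inj: "inj (\<lambda>i. x i \<omega>)" and Pl_eq: "P_l \<omega> = range (\<lambda>i. x i \<omega>)"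
      and "0 \<notin> range (\<lambda>i. x i \<omega>)"
      using range by auto
    define J where "J = {j. typical_edge L (\<lambda>i. x i \<omega>) (\<lambda>i. \<phi> i \<omega>) (P_e \<omega>) j}"
    have J: "(\<lambda>i. x i \<omega>) ` J = iS_neighbors L (\<phi> 0 \<omega>) (P_l \<omega>) (P_e \<omega>)"
      using typical_edge_iS_neighbors[OF lfe \<open>0 \<notin> range (\<lambda>i. x i \<omega>)\<close>, of \<omega> L "\<lambda>i. \<phi> i \<omega>"] elim
      by (simp add: J_def Pl_eq)
    have injJ: "inj_on (\<lambda>i. x i \<omega>) J" using inj by (rule inj_on_subset) simp
    have "N_out L x \<phi> P_e \<omega> = (if finite J then enat (card J) else \<infinity>)"
      by (simp add: N_out_def ext_out_degree_iS_graph[OF inj] J_def)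
    then have "?v \<omega> = s ^ card (iS_neighbors L (\<phi> 0 \<omega>) (P_l \<omega>) (P_e \<omega>))"
      if "finite (iS_neighbors L (\<phi> 0 \<omega>) (P_l \<omega>) (P_e \<omega>))"
      using that by (simp add: J[symmetric] card_image[OF injJ] finite_image_iff[OF injJ])
    from sandwich_pgf_bounds[OF \<open>0 < h\<close> lfl lfe _ _ this] elim enat_power_bounds[of s "N_out L x \<phi> P_e \<omega>"] s
    show ?case by (simp add: Z_def X_def)
  qed
  \<comment> \<open>Chosen so that every cell has area \<open>1 / (m + 1)\<close>, the mesh of
    \<open>riemann_geometric_limit\<close>.\<close>
  define h where "h m = real L / (pi * real (Suc m))" for m
  have h: "0 < h m" and area: "pi * h m / real L = 1 / real (Suc m)" for m
    using L by (auto simp: h_def)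
  define EZ where "EZ c t m = (\<integral>\<omega>. Z c t (h m) ((Suc m)\<^sup>2) (\<phi> 0 \<omega>, \<omega>) \<partial>M)" for c t m
  \<comment> \<open>The factor \<open>g ^ c\<close>, all that distinguishes \<open>c = 0\<close>
    from \<open>c = 1\<close> in the expectation, tends to 1.\<close>
  have EZ_lim: "EZ c t \<longlonglongrightarrow> (lam_e / (lam_e + lam_l * (1 - t))) ^ L" if c: "c \<le> 1" and t: "0 \<le> t" "t \<le> 1" for c t
  proof -
    have nn: "0 \<le> lam_l * (1 - t)" using lam t by simp
    note lim = riemann_geometric_limit[OF lam(2) nn]
    have "EZ c t = (\<lambda>m. (exp (- (lam_l * (1 - t) / real (Suc m))) ^ c) ^ L *
        (\<Sum>k<(Suc m)\<^sup>2. (exp (- (lam_e / real (Suc m))) * exp (- (lam_l * (1 - t) / real (Suc m)))) ^ k *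
          (1 - exp (- (lam_e / real (Suc m))))) ^ L)"
      unfolding EZ_def Z(2)[OF c t h] area by (simp add: power_mult_distrib del: of_nat_Suc)
    moreover have "(\<lambda>m. (exp (- (lam_l * (1 - t) / real (Suc m))) ^ c) ^ L *
        (\<Sum>k<(Suc m)\<^sup>2. (exp (- (lam_e / real (Suc m))) * exp (- (lam_l * (1 - t) / real (Suc m)))) ^ k *
          (1 - exp (- (lam_e / real (Suc m))))) ^ L) \<longlonglongrightarrow> (1 ^ c) ^ L * (lam_e / (lam_e + lam_l * (1 - t))) ^ L"
      by (intro tendsto_mult tendsto_power lim)
    ultimately show ?thesis by simp
  qed
  have lower: "EZ 1 s m \<le> (\<integral>\<omega>. ?v \<omega> \<partial>M)" for m
    unfolding EZ_def using AE_bounds[OF h, of m "(Suc m)\<^sup>2"] s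
    by (intro integral_mono_AE Z(1) v_int h) auto
  have upper: "(\<integral>\<omega>. ?v \<omega> \<partial>M) \<le> EZ 0 s m + (1 - EZ 0 1 m)" for m
  proof -
    have i: "integrable M (\<lambda>\<omega>. Z 0 s (h m) ((Suc m)\<^sup>2) (\<phi> 0 \<omega>, \<omega>))"
      "integrable M (\<lambda>\<omega>. Z 0 1 (h m) ((Suc m)\<^sup>2) (\<phi> 0 \<omega>, \<omega>))"
      using s h by (auto intro!: Z(1))
    have "(\<integral>\<omega>. ?v \<omega> \<partial>M) \<le> (\<integral>\<omega>. Z 0 s (h m) ((Suc m)\<^sup>2) (\<phi> 0 \<omega>, \<omega>) +
        (1 - Z 0 1 (h m) ((Suc m)\<^sup>2) (\<phi> 0 \<omega>, \<omega>)) \<partial>M)"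
      using AE_bounds[OF h, of m "(Suc m)\<^sup>2"] i
      by (intro integral_mono_AE v_int Bochner_Integration.integrable_add
          Bochner_Integration.integrable_diff integrable_const) auto
    also have "\<dots> = EZ 0 s m + (1 - EZ 0 1 m)"
      using i by (simp add: EZ_def prob_space)
    finally show ?thesis .
  qed
  \<comment> \<open>At \<open>s = 1\<close> the limit is \<open>(lam_e / lam_e) ^ L = 1\<close>: the
    probability of finding an eavesdropper in every sector tends to 1, and the correction
    disappears.\<close>
  have "(\<lambda>m. EZ 0 s m + (1 - EZ 0 1 m)) \<longlonglongrightarrow>
      (lam_e / (lam_e + lam_l * (1 - s))) ^ L + (1 - (lam_e / (lam_e + lam_l * (1 - 1))) ^ L)"
    using s by (intro tendsto_intros EZ_lim) auto
  then have up: "(\<lambda>m. EZ 0 s m + (1 - EZ 0 1 m)) \<longlonglongrightarrow> (lam_e / (lam_e + lam_l * (1 - s))) ^ L"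
    using lam by simp
  have lo: "EZ 1 s \<longlonglongrightarrow> (lam_e / (lam_e + lam_l * (1 - s))) ^ L"
    using s by (intro EZ_lim) auto
  show ?thesis
    by (intro antisym LIMSEQ_le_const[OF up] LIMSEQ_le_const2[OF lo]) (use lower upper in auto)
qed

section \<open>Reading off the mass function\<close>

theorem theorem4p1:
  fixes M :: "'w measure"
    and lam_l lam_e :: real
    and L :: nat
    and x :: "nat \<Rightarrow> 'w \<Rightarrow> real ^ 2"
    and \<phi> :: "nat \<Rightarrow> 'w \<Rightarrow> real"
    and P_l P_e :: "'w \<Rightarrow> (real ^ 2) set"
  assumes "prob_space M"
    and "0 < lam_l" and "0 < lam_e" and "1 \<le> L"
    and "poisson_point_process M lam_l P_l"
    and "poisson_point_process M lam_e P_e"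
    and "\<And>i. x i \<in> borel_measurable M"
    and "\<And>\<omega>. \<omega> \<in> space M \<Longrightarrow> inj (\<lambda>i. x i \<omega>) \<and> P_l \<omega> = range (\<lambda>i. x i \<omega>)"
    and "\<And>i. \<phi> i \<in> borel_measurable M"
    and "prob_space.indep_sets M
           (nth [point_process_sigma M P_l, point_process_sigma M P_e, offset_sigma M \<phi>]) {..<3}"
  shows "N_out L x \<phi> P_e \<in> M \<rightarrow>\<^sub>M count_space UNIV \<and>
    (\<forall>n::nat. measure M {\<omega>\<in>space M. N_out L x \<phi> P_e \<omega> = enat n} =
       real ((L + n - 1) choose (L - 1)) * (lam_l / (lam_l + lam_e)) ^ n * (lam_e / (lam_l + lam_e)) ^ L)"
proof -
  interpret prob_space M by fact
  define \<alpha> where "\<alpha> = lam_l / (lam_l + lam_e)"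
  define \<beta> where "\<beta> = lam_e / (lam_l + lam_e)"
  have \<alpha>: "0 < \<alpha>" "\<alpha> < 1" and \<beta>: "\<beta> = 1 - \<alpha>"
    using assms(2,3) by (auto simp: \<alpha>_def \<beta>_def field_simps)
  have N: "N_out L x \<phi> P_e \<in> M \<rightarrow>\<^sub>M count_space UNIV"
    using assms(8)
    by (intro measurable_N_out[OF assms(4) poisson_point_process_locally_finite[OF assms(6)]
        poisson_point_process_measurable[OF assms(6)] assms(7,9)]) auto
  have "prob {\<omega>\<in>space M. N_out L x \<phi> P_e \<omega> = enat n} =
      real ((L + n - 1) choose (L - 1)) * \<alpha> ^ n * \<beta> ^ L" for n
  proof (rule powser_coeffs_unique_right[
      where a = "\<lambda>n. prob {\<omega>\<in>space M. N_out L x \<phi> P_e \<omega> = enat n}"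
        and b = "\<lambda>n. real ((L + n - 1) choose (L - 1)) * \<alpha> ^ n * \<beta> ^ L"
        and f = "\<lambda>s. \<integral>\<omega>. enat_power s (N_out L x \<phi> P_e \<omega>) \<partial>M"])
    fix s :: real assume s: "0 \<le> s" "s < 1"
    show "(\<lambda>n. prob {\<omega>\<in>space M. N_out L x \<phi> P_e \<omega> = enat n} * s ^ n) sums
        (\<integral>\<omega>. enat_power s (N_out L x \<phi> P_e \<omega>) \<partial>M)"
    proof (rule pgf_sums[OF N _ s])
      show "enat_power s y = 0" if "y \<notin> range enat" for y using that by (cases y) auto
    qed (auto simp: inj_def)
    have pgf: "(\<integral>\<omega>. enat_power s (N_out L x \<phi> P_e \<omega>) \<partial>M) = (lam_e / (lam_e + lam_l * (1 - s))) ^ L"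
      by (rule N_out_pgf[OF assms(2-10) s])
    have "\<alpha> * s \<le> \<alpha> * 1" "0 \<le> \<alpha> * s" using \<alpha> s by (auto intro: mult_left_mono)
    then have as: "\<bar>\<alpha> * s\<bar> < 1" using \<alpha>(2) by linarith
    \<comment> \<open>Dividing numerator and denominator by \<open>lam_l + lam_e\<close> brings the
      generating function into the shape of the negative binomial series.\<close>
    have "lam_e / (lam_e + lam_l * (1 - s)) = \<beta> / (1 - \<alpha> * s)"
    proof -
      have "1 - \<alpha> * s = (lam_e + lam_l * (1 - s)) / (lam_l + lam_e)"
        using assms(2,3) by (simp add: \<alpha>_def field_simps)
      then show ?thesis using assms(2,3) by (simp add: \<beta>_def)
    qed
    then have "(\<integral>\<omega>. enat_power s (N_out L x \<phi> P_e \<omega>) \<partial>M) = \<beta> ^ L * (1 / (1 - \<alpha> * s) ^ L)"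
      by (simp add: pgf power_divide)
    moreover have "(\<lambda>n. \<beta> ^ L * (real ((L + n - 1) choose (L - 1)) * (\<alpha> * s) ^ n)) sums (\<beta> ^ L * (1 / (1 - \<alpha> * s) ^ L))"
      by (intro sums_mult neg_binomial_series as assms(4))
    ultimately show "(\<lambda>n. real ((L + n - 1) choose (L - 1)) * \<alpha> ^ n * \<beta> ^ L * s ^ n) sums
        (\<integral>\<omega>. enat_power s (N_out L x \<phi> P_e \<omega>) \<partial>M)"
      by (simp add: power_mult_distrib mult_ac)
  qed
  then show ?thesis using N by (simp add: \<alpha>_def \<beta>_def)
qed

end
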